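(* Let $N\ge 10^6$ and $\ell\ge 2$ be real numbers, and let $(u_p)_{p\le N}$ be complex numbers indexed by the primes $p\le N$ such that $\sum_{p\le N}|u_p|^2\le\sum_{p\le N}1$. Then $$\Bigl(\int_0^1\Bigl|\sum_{p\le N}u_p e(p\alpha)\Bigr|^{\ell}d\alpha\Bigr)^{1/\ell}\le 10^5\Bigl(\int_0^1\Bigl|\sum_{p\le N}e(p\alpha)\Bigr|^{\ell}d\alpha\Bigr)^{1/\ell}.$$
   Context: The variable $p$ always denotes a prime number, and sums over $p\le N$ run over primes. We write $e(\alpha)=\exp(2i\pi\alpha)$. *)

theory Defs
  imports "HOL-Analysis.Analysis" "HOL-Computational_Algebra.Primes"
begin

definition e :: "real \<Rightarrow> complex" where
  "e \<alpha> = exp (2 * \<i> * complex_of_real pi * complex_of_real \<alpha>)"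

definition primes_upto :: "real \<Rightarrow> nat set" where
  "primes_upto N = {p. prime p \<and> real p \<le> N}"

end

theory Submission
  imports Defs "HOL-Computational_Algebra.Squarefree" "HOL-Number_Theory.Prime_Powers"
begin

text \<open>
Write \<open>U(\<alpha>) = \<Sum> u\<^sub>p e(p\<alpha>)\<close>, let \<open>S\<close> be the same sum with all \<open>u\<^sub>p = 1\<close>, and let \<open>\<pi>\<close> be the
number of primes up to \<open>N\<close>. Both moments are compared with
\<open>(\<pi>^l / N) \<Sum> q^(1-l)\<close>, where \<open>q\<close> runs over the squarefree numbers up to about \<open>N^(1/6)\<close>.
For \<open>l\<close> close to 2 that sum has order \<open>min(log N, 1/(l-2))\<close>. It is produced by the peaks of \<open>S\<close> at the
rationals \<open>a/q\<close>, and a constant that is uniform in \<open>l\<close> near 2 is possible only because the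
bounds on both sides show the same factor.

Everything rests on one identity: if \<open>q\<close> is squarefree and the prime \<open>p\<close> does not divide \<open>q\<close>,
then \<open>\<Sum>\<^sub>a e(pa/q)\<close> over the reduced residues \<open>a\<close> is \<open>c(q) = 1\<close> or \<open>-1\<close>, whatever \<open>p\<close> is. Hence a
trigonometric sum over primes not dividing \<open>q\<close> satisfies \<open>c(q) U(x) = \<Sum>\<^sub>a U(x + a/q)\<close>.

For the lower bound, apply the identity to \<open>S\<close> near 0, where \<open>|S|\<close> is of order \<open>\<pi>\<close>: the sum of the
values \<open>S(a/q + \<beta>)\<close> has modulus at least \<open>\<pi>/4\<close>, so by the power mean inequality the sum of
their \<open>l\<close>-th powers is at least \<open>q^(1-l) (\<pi>/4)^l\<close>. The arcs \<open>a/q + [0, 1/(6N)]\<close> are disjoint, and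
integrating over them proves \<open>integral_prime_exp_sum_ge\<close>.

For the upper bound, let \<open>X\<close> be a set of \<open>m\<close> points of a translate of the grid \<open>j/N\<close>. The identity
expresses \<open>U(x)\<close> as an average of the values \<open>U(x + a/q)\<close>, so that \<open>N\<close> frequencies are sampled at
many more points than \<open>X\<close>; this is how the large sieve detects the sparsity of the primes. Using
only those \<open>q\<close> all of whose prime factors exceed \<open>4m\<^sup>2\<close> keeps the shifts of different \<open>x\<close> almost
orthogonal: they meet only through a nonzero difference \<open>a/q - a'/q'\<close>, whose denominator then has
a prime factor above \<open>4m\<^sup>2\<close>, and this saves a factor \<open>m\<close>, which pays for the \<open>m\<close> possible
partners (\<open>large_sieve_rough\<close>). The sum of \<open>1/q\<close> over these \<open>q\<close> is at least a constant times
\<open>log N / log (2m)\<close>, and so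
\<open>\<Sum>\<^sub>x |U(x)|\<^sup>2 \<le> C (N / log N) log (2m) \<Sum>\<^sub>p |u\<^sub>p|\<^sup>2\<close> (\<open>restriction_estimate\<close>).

By Chebyshev's bound and the hypothesis on \<open>u\<close> the right-hand side is at most
\<open>C' \<pi>\<^sup>2 log (2m)\<close>. As this holds for every \<open>m\<close>, the
values \<open>|U(x)|\<^sup>2\<close> on a full translated grid, in decreasing order, have partial sums dominated by those of
\<open>C'' \<pi>\<^sup>2 / i\<close>. Majorization transfers this to the \<open>l/2\<close>-th powers (\<open>sum_powr_le_of_log_sums\<close>), which
gives the bound \<open>\<Sum>\<^sub>i (C'' \<pi>\<^sup>2 / i)^(l/2)\<close> without losing a logarithm. Averaging over the translates
proves \<open>integral_exp_sum_le\<close>, and \<open>sum_powr_le_sum_squarefrees_powr\<close> matches the sum over \<open>i\<close> with the sum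
over \<open>q\<close>.
\<close>

section \<open>Primitive roots of unity and Ramanujan sums\<close>

text \<open>
Points of the circle are unit complex numbers throughout, so that a rational \<open>a/q\<close> in lowest terms
becomes a primitive \<open>q\<close>-th root of unity and congruence modulo 1 becomes equality.
\<close>

definition primitive_roots :: "nat \<Rightarrow> complex set" where
  "primitive_roots q = {\<omega>. \<forall>k. \<omega> ^ k = 1 \<longleftrightarrow> q dvd k}"

lemma primitive_rootsD: "\<omega> \<in> primitive_roots q \<Longrightarrow> \<omega> ^ k = 1 \<longleftrightarrow> q dvd k"
  by (simp add: primitive_roots_def)

lemma primitive_roots_subset: "primitive_roots q \<subseteq> {\<omega>. \<omega> ^ q = 1}"
proof
  fix \<omega> assume "\<omega> \<in> primitive_roots q"
  then show "\<omega> \<in> {\<omega>. \<omega> ^ q = 1}" using primitive_rootsD[of \<omega> q q] by simp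
qed

lemma finite_primitive_roots [simp, intro]: "q > 0 \<Longrightarrow> finite (primitive_roots q)"
  by (rule finite_subset[OF primitive_roots_subset finite_roots_unity]) auto

lemma card_primitive_roots_le: "q > 0 \<Longrightarrow> card (primitive_roots q) \<le> q"
  by (rule order_trans[OF card_mono[OF finite_roots_unity primitive_roots_subset] card_roots_unity]) auto

lemma root_of_unity_norm: "\<omega> ^ q = 1 \<Longrightarrow> q > 0 \<Longrightarrow> norm (\<omega> :: complex) = 1"
proof -
  assume "\<omega> ^ q = 1" "q > 0"
  then have "norm \<omega> ^ q = 1 ^ q" using norm_power[of \<omega> q] by simp
  then show ?thesis using power_eq_imp_eq_base[of "norm \<omega>" q 1] \<open>q > 0\<close> by simp
qed

lemma norm_primitive_root: "\<omega> \<in> primitive_roots q \<Longrightarrow> q > 0 \<Longrightarrow> norm \<omega> = 1"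
  using primitive_roots_subset root_of_unity_norm by blast

lemma primitive_roots_order_unique:
  assumes "\<omega> \<in> primitive_roots q" "\<omega> \<in> primitive_roots q'"
  shows "q = q'"
proof -
  have "q dvd k \<longleftrightarrow> q' dvd k" for k
    using primitive_rootsD[OF assms(1), of k] primitive_rootsD[OF assms(2), of k] by simp
  from this[of q] this[of q'] show ?thesis by (auto intro: dvd_antisym)
qed

lemma ex_primitive_order:
  assumes "\<omega> ^ n = (1::complex)" "n > 0"
  shows "\<exists>d. d dvd n \<and> \<omega> \<in> primitive_roots d"
proof -
  define d where "d = (LEAST k. k > 0 \<and> \<omega> ^ k = 1)"
  have d: "d > 0 \<and> \<omega> ^ d = 1"
    unfolding d_def by (rule LeastI[of "\<lambda>k. k > 0 \<and> \<omega> ^ k = 1" n]) (use assms in simp)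
  have min: "\<not> (k > 0 \<and> \<omega> ^ k = 1)" if "k < d" for k
    using not_less_Least[of k "\<lambda>k. k > 0 \<and> \<omega> ^ k = 1"] that unfolding d_def by simp
  have iff: "\<omega> ^ k = 1 \<longleftrightarrow> d dvd k" for k
  proof
    assume k: "\<omega> ^ k = 1"
    have "\<omega> ^ k = \<omega> ^ (d * (k div d) + k mod d)" by simp
    also have "\<dots> = \<omega> ^ (k mod d)" using d by (simp only: power_add power_mult) simp
    finally show "d dvd k" using min[of "k mod d"] d k by (cases "k mod d = 0") auto
  next
    assume "d dvd k"
    then show "\<omega> ^ k = 1" using d by (auto simp: power_mult)
  qed
  then have "d dvd n" "\<omega> \<in> primitive_roots d"
    using assms(1) by (simp_all add: primitive_roots_def)
  then show ?thesis by blast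
qed

lemma roots_of_unity_eq_UN_primitive_roots:
  assumes "n > 0"
  shows "{\<omega>::complex. \<omega> ^ n = 1} = (\<Union>d\<in>{d. d dvd n}. primitive_roots d)"
proof (intro set_eqI iffI)
  fix \<omega> :: complex assume "\<omega> \<in> {\<omega>. \<omega> ^ n = 1}"
  then show "\<omega> \<in> (\<Union>d\<in>{d. d dvd n}. primitive_roots d)" using ex_primitive_order[of \<omega> n] assms by simp
next
  fix \<omega> :: complex assume "\<omega> \<in> (\<Union>d\<in>{d. d dvd n}. primitive_roots d)"
  then show "\<omega> \<in> {\<omega>. \<omega> ^ n = 1}" by (auto simp: primitive_rootsD[where k = n])
qed

text \<open>
This is the Ramanujan sum \<open>c\<^sub>q(1)\<close>, which equals \<open>\<mu>(q)\<close>. For the purpose at hand only its modulus at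
squarefree \<open>q\<close> matters, and that follows from a recursion without the Moebius function.
\<close>

definition primitive_root_sum :: "nat \<Rightarrow> complex" where
  "primitive_root_sum q = (\<Sum>\<omega>\<in>primitive_roots q. \<omega>)"

lemma sum_divisors_primitive_root_sum:
  assumes "n > 0"
  shows "(\<Sum>d | d dvd n. primitive_root_sum d) = (if n = 1 then 1 else 0)"
proof -
  have "(\<Sum>d | d dvd n. primitive_root_sum d) = (\<Sum>\<omega>\<in>(\<Union>d\<in>{d. d dvd n}. primitive_roots d). \<omega>)"
    unfolding primitive_root_sum_def using assms
    by (intro sum.UNION_disjoint[symmetric]) (auto dest: primitive_roots_order_unique intro: dvd_pos_nat)
  also have "\<dots> = (\<Sum>\<omega> | \<omega> ^ n = 1. \<omega>)"
    using assms by (simp add: roots_of_unity_eq_UN_primitive_roots)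
  also have "\<dots> = (if n = 1 then 1 else 0)"
    using sum_roots_unity[of n] assms by auto
  finally show ?thesis .
qed

lemma primitive_root_sum_1: "primitive_root_sum 1 = 1"
  using sum_divisors_primitive_root_sum[of 1] by simp

text \<open>
The sums over the divisors of \<open>n\<close> and of \<open>p n\<close> are known. The divisors of \<open>p n\<close> are the \<open>d\<close> and the
\<open>p d\<close> with \<open>d\<close> dividing \<open>n\<close>; by induction the pairs with \<open>d < n\<close> cancel, and only \<open>d = n\<close> is left.
\<close>

lemma primitive_root_sum_prime_mult:
  assumes "prime p" "n > 0" "\<not> p dvd n"
  shows "primitive_root_sum (p * n) = - primitive_root_sum n"
  using assms(2,3)
proof (induction n rule: less_induct)
  case (less n)
  have p: "p > 0" "p \<noteq> 1" using assms(1) prime_gt_0_nat by (auto dest: prime_gt_1_nat)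
  have fin: "finite {d. d dvd n}" using less.prems by auto
  have split: "{d. d dvd p * n} = {d. d dvd n} \<union> (\<lambda>d. p * d) ` {d. d dvd n}"
  proof (intro set_eqI iffI)
    fix d assume d: "d \<in> {d. d dvd p * n}"
    show "d \<in> {d. d dvd n} \<union> (\<lambda>d. p * d) ` {d. d dvd n}"
    proof (cases "p dvd d")
      case True
      then obtain c where "d = p * c" by auto
      then show ?thesis using d p by auto
    next
      case False
      then have "coprime d p" using assms(1) by (metis coprime_commute prime_imp_coprime)
      then show ?thesis using d by (simp add: coprime_dvd_mult_right_iff)
    qed
  qed auto
  have disj: "{d. d dvd n} \<inter> (\<lambda>d. p * d) ` {d. d dvd n} = {}"
    using less.prems by (auto dest: dvd_mult_left)
  have "(\<Sum>d | d dvd n. primitive_root_sum d) + (\<Sum>d | d dvd n. primitive_root_sum (p * d))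
      = (\<Sum>d | d dvd p * n. primitive_root_sum d)"
    unfolding split using fin disj p
    by (subst sum.union_disjoint) (auto simp: sum.reindex inj_on_def)
  also have "\<dots> = 0"
    using sum_divisors_primitive_root_sum[of "p * n"] p less.prems by auto
  finally have 0: "(\<Sum>d | d dvd n. primitive_root_sum d + primitive_root_sum (p * d)) = 0"
    by (simp add: sum.distrib)
  have "(\<Sum>d | d dvd n. primitive_root_sum d + primitive_root_sum (p * d))
      = primitive_root_sum n + primitive_root_sum (p * n)
        + (\<Sum>d\<in>{d. d dvd n} - {n}. primitive_root_sum d + primitive_root_sum (p * d))"
    using fin by (subst sum.remove[of _ n]) auto
  also have "(\<Sum>d\<in>{d. d dvd n} - {n}. primitive_root_sum d + primitive_root_sum (p * d)) = 0"
  proof (intro sum.neutral ballI)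
    fix d assume d: "d \<in> {d. d dvd n} - {n}"
    then have "d < n" "d > 0" "\<not> p dvd d"
      using less.prems by (auto intro: dvd_pos_nat dest: dvd_trans simp: le_neq_implies_less dvd_imp_le)
    then show "primitive_root_sum d + primitive_root_sum (p * d) = 0" using less.IH by simp
  qed
  finally show ?case using 0 by (simp add: add_eq_0_iff)
qed

lemma primitive_root_sum_squarefree:
  assumes "squarefree q"
  shows "primitive_root_sum q = 1 \<or> primitive_root_sum q = -1"
  using assms
proof (induction q rule: less_induct)
  case (less q)
  have q: "q > 0" using less.prems by (metis gr0I not_squarefree_0)
  show ?case
  proof (cases "q = 1")
    case True
    then show ?thesis using primitive_root_sum_1 by simp
  next
    case False
    then obtain p where p: "prime p" "p dvd q" using prime_factor_nat by blast
    then obtain r where r: "q = p * r" by auto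
    have "\<not> p dvd r"
    proof
      assume "p dvd r"
      then have "p ^ 2 dvd q" using r by (simp add: power2_eq_square)
      then have "p dvd 1" by (rule squarefreeD[OF less.prems])
      then show False using p(1) by simp
    qed
    moreover have "r > 0" "r < q" using r q p prime_gt_1_nat[of p] by auto
    moreover have "squarefree r" using less.prems r by (metis dvd_triv_right squarefree_mono)
    ultimately show ?thesis
      using less.IH[of r] primitive_root_sum_prime_mult[of p r] p r by auto
  qed
qed

text \<open>
Raising to a power coprime to the order only permutes the primitive roots. Therefore the sum of their
\<open>k\<close>-th powers does not depend on such a \<open>k\<close>, the fact that makes the sum over shifts by \<open>a/q\<close>
insensitive to the prime frequency.
\<close>

lemma power_bij_primitive_roots:
  assumes "coprime k q" "q > 0"
  shows "bij_betw (\<lambda>\<omega>. \<omega> ^ k) (primitive_roots q) (primitive_roots q)"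
proof -
  have into: "(\<lambda>\<omega>. \<omega> ^ k) ` primitive_roots q \<subseteq> primitive_roots q"
  proof safe
    fix \<omega> assume w: "\<omega> \<in> primitive_roots q"
    have "(\<omega> ^ k) ^ j = 1 \<longleftrightarrow> q dvd j" for j
      using primitive_rootsD[OF w, of "k * j"] assms(1)
      by (simp add: power_mult coprime_dvd_mult_right_iff coprime_commute)
    then show "\<omega> ^ k \<in> primitive_roots q" by (simp add: primitive_roots_def)
  qed
  have "inj_on (\<lambda>\<omega>. \<omega> ^ k) (primitive_roots q)"
  proof (rule inj_onI)
    fix x y assume x: "x \<in> primitive_roots q" and y: "y \<in> primitive_roots q" and eq: "x ^ k = y ^ k"
    have xy: "x \<noteq> 0" "y \<noteq> 0" using norm_primitive_root[OF x assms(2)] norm_primitive_root[OF y assms(2)] by auto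
    have 1: "(x / y) ^ q = 1" "(x / y) ^ k = 1"
      using primitive_rootsD[OF x, of q] primitive_rootsD[OF y, of q] xy eq by (simp_all add: power_divide)
    obtain d where d: "d dvd q" "x / y \<in> primitive_roots d" using ex_primitive_order[OF 1(1) assms(2)] by auto
    have "d dvd k" using 1(2) d(2) by (simp add: primitive_rootsD)
    then have "d = 1" using d(1) assms(1) by (meson coprime_def nat_dvd_1_iff_1)
    then have "x / y = 1" using primitive_rootsD[OF d(2), of 1] by simp
    then show "x = y" using xy by simp
  qed
  then show ?thesis using into assms(2)
    unfolding bij_betw_def using endo_inj_surj[OF finite_primitive_roots into] by blast
qed

lemma sum_primitive_roots_power:
  assumes "coprime k q" "q > 0"
  shows "(\<Sum>\<omega>\<in>primitive_roots q. \<omega> ^ k) = primitive_root_sum q"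
  unfolding primitive_root_sum_def
  using sum.reindex_bij_betw[OF power_bij_primitive_roots[OF assms], of "\<lambda>\<omega>. \<omega>"] .

lemma norm_power_minus_1_le:
  assumes "norm (\<omega>::complex) = 1"
  shows "norm (\<omega> ^ k - 1) \<le> real k * norm (\<omega> - 1)"
proof (induction k)
  case (Suc k)
  have "\<omega> ^ Suc k - 1 = \<omega> * (\<omega> ^ k - 1) + (\<omega> - 1)" by (simp add: algebra_simps)
  then have "norm (\<omega> ^ Suc k - 1) \<le> norm (\<omega> * (\<omega> ^ k - 1)) + norm (\<omega> - 1)"
    by (metis norm_triangle_ineq)
  also have "\<dots> \<le> real k * norm (\<omega> - 1) + norm (\<omega> - 1)"
    using Suc assms by (simp add: norm_mult)
  finally show ?case by (simp add: distrib_right)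
qed simp

text \<open>
A fraction with denominator \<open>n\<close> that is not an integer stays away from the integers. In terms of
\<open>\<omega>\<close>: the powers \<open>\<omega>^k\<close> with \<open>k < n\<close> add up to 0, so they cannot all be close to 1.
\<close>

lemma root_of_unity_distance_1:
  assumes "\<omega> ^ n = 1" "n > 0" "\<omega> \<noteq> (1::complex)"
  shows "1 \<le> real n * norm (\<omega> - 1)"
proof -
  have w: "norm \<omega> = 1" using root_of_unity_norm assms by blast
  have "(\<Sum>k<n. \<omega> ^ k) = 0" using assms by (simp add: geometric_sum)
  then have "real n = norm (\<Sum>k<n. (\<omega> ^ k - 1))" by (simp add: sum_subtractf)
  also have "\<dots> \<le> (\<Sum>k<n. real k * norm (\<omega> - 1))"
    using norm_power_minus_1_le[OF w] by (intro sum_norm_le) auto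
  also have "\<dots> \<le> (\<Sum>k<n. real n * norm (\<omega> - 1))"
    by (intro sum_mono mult_right_mono) auto
  finally have "real n * 1 \<le> real n * (real n * norm (\<omega> - 1))" by simp
  then show ?thesis using assms(2) by (simp only: mult_le_cancel_left_pos of_nat_0_less_iff)
qed

section \<open>Reciprocals of squarefree, smooth and rough numbers\<close>

lemma squarefree_pos: "squarefree (q::nat) \<Longrightarrow> q > 0"
  by (metis gr0I not_squarefree_0)

lemma sum_inverse_multiples_le:
  fixes S :: "nat set"
  assumes "finite S" and pos: "\<And>s. s \<in> S \<Longrightarrow> s > 0" and "p > 0"
    and down: "\<And>s d. s \<in> S \<Longrightarrow> d dvd s \<Longrightarrow> d \<in> S"
  shows "(\<Sum>s\<in>{s\<in>S. p dvd s}. 1 / real s) \<le> (1 / real p) * (\<Sum>s\<in>S. 1 / real s)"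
proof -
  have "(\<Sum>s\<in>{s\<in>S. p dvd s}. 1 / real s) \<le> (\<Sum>s\<in>S. 1 / (real p * real s))"
  proof (rule sum_le_included[where i = "\<lambda>s. p * s"])
    show "\<forall>x\<in>{s \<in> S. p dvd s}. \<exists>y\<in>S. p * y = x \<and> 1 / real x \<le> 1 / (real p * real y)"
    proof
      fix x assume x: "x \<in> {s \<in> S. p dvd s}"
      then obtain y where y: "x = p * y" by auto
      then have "y \<in> S" using x down[of x y] by simp
      then show "\<exists>y\<in>S. p * y = x \<and> 1 / real x \<le> 1 / (real p * real y)" using y by auto
    qed
  qed (use assms in auto)
  then show ?thesis by (simp add: sum_distrib_left)
qed

definition squarefrees :: "nat \<Rightarrow> nat set" where
  "squarefrees y = {q. squarefree q \<and> q \<le> y}"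

lemma finite_squarefrees [simp]: "finite (squarefrees y)"
  unfolding squarefrees_def by (rule finite_subset[of _ "{..y}"]) auto

lemma sum_inverse_squares_le: "(\<Sum>d=1..n. 1 / (real d)\<^sup>2) \<le> 2"
proof -
  have "(\<Sum>d=1..Suc n. 1 / (real d)\<^sup>2) \<le> 2 - 1 / real (Suc n)" for n
  proof (induction n)
    case (Suc n)
    have "1 / (real (Suc (Suc n)))\<^sup>2 \<le> 1 / (real (Suc n) * real (Suc (Suc n)))"
      by (intro divide_left_mono) (auto simp: power2_eq_square)
    also have "\<dots> = 1 / real (Suc n) - 1 / real (Suc (Suc n))" by (simp add: divide_simps)
    finally show ?case using Suc by simp
  qed simp
  note * = this
  show ?thesis
  proof (cases n)
    case (Suc m)
    then show ?thesis using *[of m] by (smt (verit) divide_nonneg_nonneg of_nat_0_le_iff)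
  qed simp
qed

text \<open>
Every \<open>n\<close> is \<open>q d\<^sup>2\<close> with \<open>q\<close> squarefree, so the harmonic sum is at most the sum over \<open>q\<close> times
\<open>\<Sum> 1/d\<^sup>2 \<le> 2\<close>.
\<close>

lemma ln_le_sum_squarefrees:
  "ln (real y + 1) \<le> 2 * (\<Sum>q\<in>squarefrees y. 1 / real q)"
proof -
  have "ln (real y + 1) \<le> (\<Sum>n=1..y. 1 / real n)"
    using ln_le_harm[of y] by (simp add: harm_def inverse_eq_divide)
  also have "\<dots> \<le> (\<Sum>(q,d)\<in>squarefrees y \<times> {1..y}. 1 / real q * (1 / (real d)\<^sup>2))"
  proof (rule sum_le_included[where i = "\<lambda>(q,d). q * d^2"])
    show "\<forall>n\<in>{1..y}. \<exists>x\<in>squarefrees y \<times> {1..y}. (case x of (q, d) \<Rightarrow> q * d\<^sup>2) = n \<and>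
            1 / real n \<le> (case x of (q, d) \<Rightarrow> 1 / real q * (1 / (real d)\<^sup>2))"
    proof
      fix n assume n: "n \<in> {1..y}"
      define q d where "q = squarefree_part n" and "d = square_part n"
      have nqd: "n = q * d^2" using squarefree_decompose[of n] by (simp add: q_def d_def)
      then have qd: "q > 0" "d > 0" using n by (auto intro!: Nat.gr0I)
      then have "q \<le> n" "d \<le> n" using n nqd
        by (auto intro!: dvd_imp_le simp: power2_eq_square)
      moreover have "squarefree q" by (simp add: q_def)
      ultimately have "(q, d) \<in> squarefrees y \<times> {1..y}" using n qd by (auto simp: squarefrees_def)
      moreover have "1 / real n = 1 / real q * (1 / (real d)\<^sup>2)" by (simp add: nqd)
      ultimately show "\<exists>x\<in>squarefrees y \<times> {1..y}. (case x of (q, d) \<Rightarrow> q * d\<^sup>2) = n \<and>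
            1 / real n \<le> (case x of (q, d) \<Rightarrow> 1 / real q * (1 / (real d)\<^sup>2))"
        using nqd by (intro bexI[of _ "(q, d)"]) auto
    qed
  qed auto
  also have "\<dots> = (\<Sum>q\<in>squarefrees y. 1 / real q) * (\<Sum>d=1..y. 1 / (real d)\<^sup>2)"
    by (simp add: sum_product sum.cartesian_product)
  also have "\<dots> \<le> (\<Sum>q\<in>squarefrees y. 1 / real q) * 2"
    by (intro mult_left_mono sum_inverse_squares_le sum_nonneg) auto
  finally show ?thesis by simp
qed

text \<open>
Only squarefree numbers are kept in both sets, because the Ramanujan sum vanishes at the other moduli.
\<close>

definition rough :: "nat \<Rightarrow> nat \<Rightarrow> nat set" where
  "rough M z = {q\<in>squarefrees z. \<forall>p. prime p \<longrightarrow> p dvd q \<longrightarrow> M < p}"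

definition smooth :: "nat \<Rightarrow> nat \<Rightarrow> nat set" where
  "smooth M z = {q\<in>squarefrees z. \<forall>p. prime p \<longrightarrow> p dvd q \<longrightarrow> p \<le> M}"

lemma finite_rough [simp]: "finite (rough M z)" and finite_smooth [simp]: "finite (smooth M z)"
  by (simp_all add: rough_def smooth_def)

lemma smooth_rough_decomposition:
  "n > 0 \<Longrightarrow> \<exists>s r. n = s * r \<and> (\<forall>p. prime p \<longrightarrow> p dvd s \<longrightarrow> p \<le> M) \<and> (\<forall>p. prime p \<longrightarrow> p dvd r \<longrightarrow> M < (p::nat))"
proof (induction n rule: less_induct)
  case (less n)
  show ?case
  proof (cases "n = 1")
    case True
    then show ?thesis by (intro exI[of _ 1]) auto
  next
    case False
    then obtain p where p: "prime p" "p dvd n" using prime_factor_nat by blast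
    then obtain m where m: "n = p * m" by auto
    have "m < n" "m > 0" using m less.prems prime_gt_1_nat[OF p(1)] by auto
    then obtain s r where sr: "m = s * r" "\<forall>p. prime p \<longrightarrow> p dvd s \<longrightarrow> p \<le> M" "\<forall>p. prime p \<longrightarrow> p dvd r \<longrightarrow> M < p"
      using less.IH by blast
    show ?thesis
    proof (cases "p \<le> M")
      case True
      have "\<forall>p'. prime p' \<longrightarrow> p' dvd p * s \<longrightarrow> p' \<le> M"
        using True sr(2) p(1) by (auto simp: prime_dvd_mult_iff dest: primes_dvd_imp_eq)
      then show ?thesis using sr m by (intro exI[of _ "p * s"] exI[of _ r]) (simp add: mult.assoc)
    next
      case False
      have "\<forall>p'. prime p' \<longrightarrow> p' dvd p * r \<longrightarrow> M < p'"
        using False sr(3) p(1) by (auto simp: prime_dvd_mult_iff dest: primes_dvd_imp_eq)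
      then show ?thesis using sr m by (intro exI[of _ s] exI[of _ "p * r"]) (simp add: mult_ac)
    qed
  qed
qed

lemma squarefrees_down: "s \<in> squarefrees y \<Longrightarrow> d dvd s \<Longrightarrow> d \<in> squarefrees y"
  using squarefree_mono[of d s] dvd_imp_le[of d s] squarefree_pos[of s] by (auto simp: squarefrees_def)

lemma rough_down: "s \<in> rough M y \<Longrightarrow> d dvd s \<Longrightarrow> d \<in> rough M y"
  unfolding rough_def using squarefrees_down by (blast intro: dvd_trans)

lemma smooth_down: "s \<in> smooth M y \<Longrightarrow> d dvd s \<Longrightarrow> d \<in> smooth M y"
  unfolding smooth_def using squarefrees_down by (blast intro: dvd_trans)

lemma rough_pos: "s \<in> rough M y \<Longrightarrow> s > 0" and smooth_pos: "s \<in> smooth M y \<Longrightarrow> s > 0"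
  by (auto simp: rough_def smooth_def squarefrees_def squarefree_pos)

lemma sum_squarefrees_le_smooth_rough:
  "(\<Sum>q\<in>squarefrees z. 1 / real q) \<le> (\<Sum>s\<in>smooth M z. 1 / real s) * (\<Sum>r\<in>rough M z. 1 / real r)"
proof -
  have "(\<Sum>q\<in>squarefrees z. 1 / real q) \<le> (\<Sum>(s,r)\<in>smooth M z \<times> rough M z. 1 / real s * (1 / real r))"
  proof (rule sum_le_included[where i = "\<lambda>(s,r). s * r"])
    show "\<forall>n\<in>squarefrees z. \<exists>x\<in>smooth M z \<times> rough M z. (case x of (s, r) \<Rightarrow> s * r) = n \<and>
            1 / real n \<le> (case x of (s, r) \<Rightarrow> 1 / real s * (1 / real r))"
    proof
      fix n assume n: "n \<in> squarefrees z"
      then have "n > 0" by (simp add: squarefrees_def squarefree_pos)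
      then obtain s r where sr: "n = s * r" "\<forall>p. prime p \<longrightarrow> p dvd s \<longrightarrow> p \<le> M" "\<forall>p. prime p \<longrightarrow> p dvd r \<longrightarrow> M < p"
        using smooth_rough_decomposition by blast
      have "s \<in> squarefrees z" "r \<in> squarefrees z" using squarefrees_down[OF n] sr(1) by auto
      then have "s \<in> smooth M z" "r \<in> rough M z" using sr(2,3) by (simp_all add: smooth_def rough_def)
      then show "\<exists>x\<in>smooth M z \<times> rough M z. (case x of (s, r) \<Rightarrow> s * r) = n \<and>
            1 / real n \<le> (case x of (s, r) \<Rightarrow> 1 / real s * (1 / real r))"
        using sr(1) by (intro bexI[of _ "(s, r)"]) auto
    qed
  qed auto
  then show ?thesis by (simp add: sum_product sum.cartesian_product)
qed

lemma ln_squarefree_le: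
  "squarefree s \<Longrightarrow> ln (real s) \<le> (\<Sum>p | prime p \<and> p dvd s. ln (real p))"
proof (induction s rule: less_induct)
  case (less s)
  show ?case
  proof (cases "s = 1")
    case False
    then obtain p where p: "prime p" "p dvd s" using prime_factor_nat by blast
    then obtain m where m: "s = p * m" by auto
    have s0: "s > 0" using less.prems squarefree_pos by blast
    have m': "m < s" "m > 0" "squarefree m"
      using m s0 prime_gt_1_nat[OF p(1)] squarefree_mono[of m s] less.prems by auto
    have ndvd: "\<not> p dvd m"
    proof
      assume "p dvd m"
      then have "p ^ 2 dvd s" using m by (simp add: power2_eq_square)
      then have "p dvd 1" by (rule squarefreeD[OF less.prems])
      then show False using p(1) by simp
    qed
    have eq: "{q. prime q \<and> q dvd s} = insert p {q. prime q \<and> q dvd m}"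
      using p(1) by (auto simp: m prime_dvd_mult_iff dest: primes_dvd_imp_eq)
    have fin: "finite {q. prime q \<and> q dvd m}"
      using m'(2) by (intro finite_subset[OF _ finite_divisors_nat[of m]]) auto
    have "ln (real s) = ln (real p) + ln (real m)"
      using m m' prime_gt_0_nat[OF p(1)] by (simp add: ln_mult)
    also have "\<dots> \<le> ln (real p) + (\<Sum>q | prime q \<and> q dvd m. ln (real q))"
      using less.IH[OF m'(1,3)] by simp
    also have "\<dots> = (\<Sum>q | prime q \<and> q dvd s. ln (real q))"
      unfolding eq using fin ndvd by (subst sum.insert) auto
    finally show ?thesis .
  qed auto
qed

lemma ln_fact_eq_sum_mangoldt:
  "ln (fact n :: real) = (\<Sum>d=1..n. mangoldt d * real (n div d))"
proof (induction n)
  case (Suc n)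
  have "(\<Sum>d=1..Suc n. mangoldt d * real (Suc n div d))
      = (\<Sum>d=1..Suc n. mangoldt d * real (n div d) + (if d dvd Suc n then mangoldt d else 0))"
    by (intro sum.cong refl) (simp add: div_Suc dvd_eq_mod_eq_0 distrib_left)
  also have "\<dots> = (\<Sum>d=1..Suc n. mangoldt d * real (n div d)) + (\<Sum>d\<in>{d\<in>{1..Suc n}. d dvd Suc n}. mangoldt d)"
    by (simp only: sum.distrib sum.inter_filter[OF finite_atLeastAtMost])
  also have "{d\<in>{1..Suc n}. d dvd Suc n} = {d. d dvd Suc n}"
    by (auto dest: dvd_imp_le intro!: Suc_leI Nat.gr0I)
  also have "(\<Sum>d | d dvd Suc n. mangoldt d) = ln (real (Suc n))"
    by (subst mangoldt_sum) auto
  also have "(\<Sum>d=1..Suc n. mangoldt d * real (n div d)) = ln (fact n :: real)"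
    using Suc by simp
  finally show ?case
    by (simp add: ln_mult del: of_nat_Suc)
qed simp

text \<open>
Mertens' upper bound up to a factor: \<open>M!\<close> contains each prime \<open>p \<le> M\<close> to a power of at least
\<open>\<lfloor>M/p\<rfloor> \<ge> M/(2p)\<close>, while \<open>ln (M!) \<le> M ln M\<close>.
\<close>

lemma sum_ln_prime_over_prime_le:
  assumes "M \<ge> 1"
  shows "(\<Sum>p | prime p \<and> p \<le> M. ln (real p) / real p) \<le> 2 * ln (real M)"
proof -
  let ?P = "{p. prime p \<and> p \<le> M}"
  have "real M / 2 * (\<Sum>p\<in>?P. ln (real p) / real p) = (\<Sum>p\<in>?P. ln (real p) * (real M / (2 * real p)))"
    by (simp add: sum_distrib_left field_simps)
  also have "\<dots> \<le> (\<Sum>p\<in>?P. ln (real p) * real (M div p))"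
  proof (intro sum_mono mult_left_mono)
    fix p assume p: "p \<in> ?P"
    then have p0: "p > 0" using prime_gt_0_nat by auto
    then have "M div p \<ge> 1" using p by (simp add: Suc_le_eq div_greater_zero_iff)
    moreover have "M < p * (M div p) + p"
      using p0 by (metis add.commute dividend_less_times_div)
    ultimately have "M \<le> 2 * p * (M div p)"
      by (smt (verit) add_mult_distrib2 mult_2 mult_le_mono2 nat_mult_1_right le_trans less_imp_le_nat add_le_mono le_refl mult.assoc)
    then have "real M \<le> real (2 * p * (M div p))" by (simp only: of_nat_le_iff)
    then show "real M / (2 * real p) \<le> real (M div p)"
      using p0 by (simp add: divide_le_eq mult_ac)
  next
    fix p assume p: "p \<in> ?P"
    then show "0 \<le> ln (real p)" using prime_gt_1_nat[of p] by auto
  qed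
  also have "\<dots> = (\<Sum>p\<in>?P. mangoldt p * real (M div p))"
    by (intro sum.cong) auto
  also have "\<dots> \<le> (\<Sum>d=1..M. mangoldt d * real (M div d))"
    by (intro sum_mono2) (auto simp: mangoldt_nonneg prime_gt_0_nat Suc_le_eq)
  also have "\<dots> = ln (fact M)" by (simp add: ln_fact_eq_sum_mangoldt)
  also have "\<dots> \<le> ln (real M ^ M)"
    using assms fact_le_power[of M, where ?'a = real] by (subst ln_le_cancel_iff) auto
  also have "\<dots> = real M * ln (real M)" using assms by (simp add: ln_realpow)
  finally have "real M / 2 * (\<Sum>p\<in>?P. ln (real p) / real p) \<le> real M / 2 * (2 * ln (real M))" by simp
  then show ?thesis using assms by (simp only: mult_le_cancel_left_pos)
qed

text \<open>
Write \<open>ln s\<close> as the sum of \<open>ln p\<close> over the primes dividing \<open>s\<close> and interchange the summations. Removing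
the factor \<open>p\<close> from its multiples shows that they carry at most \<open>1/p\<close> of the whole sum.
\<close>

lemma sum_ln_over_smooth_le:
  "(\<Sum>s\<in>smooth M z. ln (real s) / real s)
     \<le> (\<Sum>p | prime p \<and> p \<le> M. ln (real p) / real p) * (\<Sum>s\<in>smooth M z. 1 / real s)"
proof -
  let ?P = "{p. prime p \<and> p \<le> M}" and ?S = "smooth M z"
  have finP: "finite ?P" by simp
  have "(\<Sum>s\<in>?S. ln (real s) / real s) \<le> (\<Sum>s\<in>?S. \<Sum>p\<in>{p\<in>?P. p dvd s}. ln (real p) / real s)"
  proof (rule sum_mono)
    fix s assume s: "s \<in> ?S"
    have eq: "{p\<in>?P. p dvd s} = {p. prime p \<and> p dvd s}"
      using s by (auto simp: smooth_def)
    have "ln (real s) \<le> (\<Sum>p\<in>{p\<in>?P. p dvd s}. ln (real p))"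
      unfolding eq using s ln_squarefree_le by (simp add: smooth_def squarefrees_def)
    then show "ln (real s) / real s \<le> (\<Sum>p\<in>{p\<in>?P. p dvd s}. ln (real p) / real s)"
      by (simp add: divide_right_mono flip: sum_divide_distrib)
  qed
  also have "\<dots> = (\<Sum>p\<in>?P. \<Sum>s\<in>{s\<in>?S. p dvd s}. ln (real p) / real s)"
    by (rule sum.swap_restrict) (auto simp: finP)
  also have "\<dots> = (\<Sum>p\<in>?P. ln (real p) * (\<Sum>s\<in>{s\<in>?S. p dvd s}. 1 / real s))"
    by (simp add: sum_distrib_left)
  also have "\<dots> \<le> (\<Sum>p\<in>?P. ln (real p) * ((1 / real p) * (\<Sum>s\<in>?S. 1 / real s)))"
  proof (intro sum_mono mult_left_mono sum_inverse_multiples_le)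
    fix p assume "p \<in> ?P" then show "0 \<le> ln (real p)" "p > 0" using prime_gt_1_nat[of p] by auto
  qed (auto simp: smooth_pos intro: smooth_down)
  also have "\<dots> = (\<Sum>p\<in>?P. ln (real p) / real p) * (\<Sum>s\<in>?S. 1 / real s)"
    by (simp add: sum_distrib_right)
  finally show ?thesis .
qed

text \<open>
A substitute for the Euler product over the primes up to \<open>M\<close>. The weighted mean of \<open>ln s\<close> over the
smooth numbers, with weights \<open>1/s\<close>, is at most \<open>B = 2 ln M\<close>. By Markov's inequality the \<open>s\<close> with
\<open>ln s > 2 B\<close> carry at most half of the total, and the others contribute at most a harmonic sum of length
\<open>exp (2 B)\<close>.
\<close>

lemma sum_inverse_smooth_le:
  assumes "M \<ge> 2"
  shows "(\<Sum>s\<in>smooth M z. 1 / real s) \<le> 2 + 8 * ln (real M)"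
proof -
  define T where "T = (\<Sum>s\<in>smooth M z. 1 / real s)"
  define B where "B = 2 * ln (real M)"
  define y where "y = exp (2 * B)"
  have B0: "B > 0" using assms by (simp add: B_def)
  have T0: "T \<ge> 0" by (simp add: T_def sum_nonneg)
  let ?L = "{s\<in>smooth M z. real s \<le> y}" and ?U = "{s\<in>smooth M z. \<not> real s \<le> y}"
  have "2 * B * (\<Sum>s\<in>?U. 1 / real s) \<le> (\<Sum>s\<in>?U. ln (real s) / real s)"
    unfolding sum_distrib_left
  proof (rule sum_mono)
    fix s assume s: "s \<in> ?U"
    then have "2 * B \<le> ln (real s)" by (auto simp: y_def not_le ln_ge_iff smooth_pos)
    then show "2 * B * (1 / real s) \<le> ln (real s) / real s" by (simp add: divide_right_mono)
  qed
  also have "\<dots> \<le> (\<Sum>s\<in>smooth M z. ln (real s) / real s)"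
    by (intro sum_mono2) (auto simp: Suc_le_eq dest: smooth_pos)
  also have "\<dots> \<le> (\<Sum>p | prime p \<and> p \<le> M. ln (real p) / real p) * T"
    unfolding T_def by (rule sum_ln_over_smooth_le)
  also have "\<dots> \<le> B * T"
    unfolding B_def using assms T0 by (intro mult_right_mono sum_ln_prime_over_prime_le) auto
  finally have U: "(\<Sum>s\<in>?U. 1 / real s) \<le> T / 2" using B0 by simp
  have "(\<Sum>s\<in>?L. 1 / real s) \<le> (\<Sum>s=1..nat \<lfloor>y\<rfloor>. 1 / real s)"
    by (intro sum_mono2) (auto simp: le_nat_floor Suc_le_eq smooth_pos)
  also have "\<dots> = harm (nat \<lfloor>y\<rfloor>)" by (simp add: harm_def inverse_eq_divide)
  also have "\<dots> \<le> 1 + ln (real (nat \<lfloor>y\<rfloor>))"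
  proof -
    have "y \<ge> 1" using B0 by (simp add: y_def)
    then have "nat \<lfloor>y\<rfloor> > 0" by (simp add: le_floor_iff)
    then show ?thesis
      using decseqD[OF decseq_harm_diff_ln, of 0 "nat \<lfloor>y\<rfloor> - 1"] by (simp add: harm_expand)
  qed
  also have "\<dots> \<le> 1 + 2 * B"
  proof -
    have "y \<ge> 1" using B0 by (simp add: y_def)
    then have "ln (real (nat \<lfloor>y\<rfloor>)) \<le> ln y" by (subst ln_le_cancel_iff) (auto simp: le_floor_iff)
    then show ?thesis by (simp add: y_def)
  qed
  finally have L: "(\<Sum>s\<in>?L. 1 / real s) \<le> 1 + 2 * B" .
  have "T = (\<Sum>s\<in>?L \<union> ?U. 1 / real s)" unfolding T_def by (intro sum.cong) auto
  also have "\<dots> = (\<Sum>s\<in>?L. 1 / real s) + (\<Sum>s\<in>?U. 1 / real s)"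
    by (intro sum.union_disjoint) auto
  finally have "T \<le> 1 + 2 * B + T / 2" using L U by linarith
  then show ?thesis unfolding T_def[symmetric] B_def by simp
qed

text \<open>
The lower bound of a sieve: factoring each squarefree number into a smooth and a rough part shows that the
rough numbers carry at least the proportion \<open>1 / ln M\<close> of the harmonic sum, up to a constant.
\<close>

lemma ln_le_sum_rough:
  assumes "M \<ge> 2"
  shows "ln (real z + 1) \<le> (4 + 16 * ln (real M)) * (\<Sum>r\<in>rough M z. 1 / real r)"
proof -
  have "ln (real z + 1) \<le> 2 * (\<Sum>q\<in>squarefrees z. 1 / real q)" by (rule ln_le_sum_squarefrees)
  also have "\<dots> \<le> 2 * ((\<Sum>s\<in>smooth M z. 1 / real s) * (\<Sum>r\<in>rough M z. 1 / real r))"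
    using sum_squarefrees_le_smooth_rough by simp
  also have "\<dots> \<le> 2 * ((2 + 8 * ln (real M)) * (\<Sum>r\<in>rough M z. 1 / real r))"
    using assms by (intro mult_left_mono mult_right_mono sum_inverse_smooth_le sum_nonneg) auto
  finally show ?thesis by (simp add: algebra_simps)
qed

section \<open>Chebyshev's lower bound for the number of primes\<close>

text \<open>
The powers of a prime \<open>p\<close> up to \<open>n\<close> contribute \<open>ln p\<close> each, hence together the logarithm of the largest
of them, which is at most \<open>ln n\<close>.
\<close>

lemma sum_mangoldt_le:
  assumes "n \<ge> 1"
  shows "(\<Sum>d=1..n. mangoldt d) \<le> real (card {p. prime p \<and> p \<le> n}) * ln (real n)"
proof -
  let ?P = "{p. prime p \<and> p \<le> n}" and ?D = "{d\<in>{1..n}. primepow d}"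
  have finP: "finite ?P" by simp
  have "(\<Sum>d=1..n. mangoldt d) = (\<Sum>d\<in>?D. ln (real (aprimedivisor d)))"
    by (subst sum.inter_filter) (auto simp: mangoldt_def intro!: sum.cong)
  also have "\<dots> = (\<Sum>p\<in>?P. \<Sum>d\<in>{d\<in>?D. aprimedivisor d = p}. ln (real (aprimedivisor d)))"
  proof (rule sum.group[symmetric])
    show "aprimedivisor ` ?D \<subseteq> ?P"
    proof
      fix p assume "p \<in> aprimedivisor ` ?D"
      then obtain d where d: "d \<in> ?D" "p = aprimedivisor d" by auto
      then have "d > Suc 0" using primepow_gt_Suc_0 by auto
      then show "p \<in> ?P" using d aprimedivisor_nat(1)[of d] aprimedivisor_le_nat[of d] by auto
    qed
  qed auto
  also have "\<dots> \<le> (\<Sum>p\<in>?P. ln (real n))"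
  proof (rule sum_mono)
    fix p assume p: "p \<in> ?P"
    then have p1: "p > 1" using prime_gt_1_nat by auto
    define E where "E = {k. k \<ge> 1 \<and> p ^ k \<le> n}"
    have Esub: "E \<subseteq> {1..n}"
      using p1 by (auto simp: E_def) (meson le_trans less_imp_le_nat power_gt_expt)
    then have finE: "finite E" using finite_subset by blast
    have "1 \<in> E" using p by (simp add: E_def)
    define K where "K = Max E"
    have K: "K \<in> E" using finE \<open>1 \<in> E\<close> Max_in unfolding K_def by blast
    have "{d\<in>?D. aprimedivisor d = p} \<subseteq> (\<lambda>k. p ^ k) ` E"
    proof
      fix d assume d: "d \<in> {d\<in>?D. aprimedivisor d = p}"
      then have "primepow d" by simp
      then obtain p' k where pk: "prime p'" "k > 0" "d = p' ^ k" by (auto simp: primepow_def)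
      then have "p' = p" using d by (simp add: aprimedivisor_prime_power)
      then show "d \<in> (\<lambda>k. p ^ k) ` E" using pk d by (auto simp: E_def)
    qed
    then have "card {d\<in>?D. aprimedivisor d = p} \<le> card E"
      by (rule surj_card_le[OF finE])
    also have "\<dots> \<le> card {1..K}"
    proof (intro card_mono)
      show "E \<subseteq> {1..K}" using Max_ge[OF finE] by (auto simp: K_def E_def)
    qed auto
    finally have card: "card {d\<in>?D. aprimedivisor d = p} \<le> K" by simp
    have "(\<Sum>d\<in>{d\<in>?D. aprimedivisor d = p}. ln (real (aprimedivisor d)))
        = real (card {d\<in>?D. aprimedivisor d = p}) * ln (real p)"
      by simp
    also have "\<dots> \<le> real K * ln (real p)" using card p1 by (intro mult_right_mono) auto
    also have "\<dots> = ln (real (p ^ K))" using p1 by (simp add: ln_realpow)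
    also have "\<dots> \<le> ln (real n)" using K p1 assms unfolding E_def
      by (subst ln_le_cancel_iff) (auto simp del: of_nat_power)
    finally show "(\<Sum>d\<in>{d\<in>?D. aprimedivisor d = p}. ln (real (aprimedivisor d))) \<le> ln (real n)" .
  qed
  finally show ?thesis by simp
qed

text \<open>
The central binomial coefficient is at least \<open>2^k\<close>. In its logarithm each \<open>\<Lambda>(d)\<close> with \<open>d \<le> 2k\<close> has
coefficient 0 or 1, so it is bounded by \<open>\<psi>(2k)\<close>, which is at most \<open>\<pi>(n) ln n\<close>.
\<close>

lemma chebyshev_lower_bound:
  assumes "n \<ge> 4"
  shows "real n \<le> 4 * real (card {p. prime p \<and> p \<le> n}) * ln (real n)"
proof -
  define k where "k = n div 2"
  have k: "k \<ge> 1" "2 * k \<le> n" "real n \<le> 2 * real k + 1" using assms by (auto simp: k_def)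
  have "2 * real k \<le> 2 ^ k"
    using k(1) by (induction k rule: dec_induct) auto
  then have "(2::real) ^ k \<le> 4 ^ k / (2 * real k)"
  proof -
    have "(2::real) ^ k * (2 * real k) \<le> 2 ^ k * 2 ^ k"
      using \<open>2 * real k \<le> 2 ^ k\<close> by (intro mult_left_mono) auto
    also have "\<dots> = 4 ^ k" by (simp flip: power_mult_distrib)
    finally show ?thesis using k(1) by (simp add: le_divide_eq)
  qed
  also have "\<dots> \<le> real (2 * k choose k)"
    using central_binomial_lower_bound[of k] k(1) by simp
  finally have "ln (2 ^ k) \<le> ln (real (2 * k choose k))"
    by (subst ln_le_cancel_iff) auto
  also have "ln (real (2 * k choose k)) = ln (fact (2 * k)) - 2 * ln (fact k)"
    by (simp add: binomial_fact ln_div ln_mult)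
  also have "\<dots> = (\<Sum>d=1..2*k. mangoldt d * (real (2 * k div d) - 2 * real (k div d)))"
  proof -
    have "ln (fact k :: real) = (\<Sum>d=1..2*k. mangoldt d * real (k div d))"
      unfolding ln_fact_eq_sum_mangoldt by (rule sum.mono_neutral_left) auto
    then show ?thesis
      unfolding ln_fact_eq_sum_mangoldt[of "2 * k"]
      by (simp only: sum_distrib_left flip: sum_subtractf) (simp add: algebra_simps)
  qed
  also have "\<dots> \<le> (\<Sum>d=1..2*k. mangoldt d * 1)"
  proof (intro sum_mono mult_left_mono mangoldt_nonneg)
    fix d assume d: "d \<in> {1..2*k}"
    have "2 * k div d \<le> 2 * (k div d) + 1"
    proof -
      have "k < d * (k div d) + d" using d by (metis add.commute atLeastAtMost_iff dividend_less_times_div less_le_trans zero_less_one)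
      then have "2 * k < (2 * (k div d) + 2) * d" by (simp add: algebra_simps)
      then have "2 * k div d < 2 * (k div d) + 2" using d by (simp add: less_mult_imp_div_less)
      then show ?thesis by simp
    qed
    then show "real (2 * k div d) - 2 * real (k div d) \<le> 1" by linarith
  qed
  also have "\<dots> \<le> (\<Sum>d=1..n. mangoldt d)"
    unfolding mult_1_right using k by (intro sum_mono2) (auto simp: mangoldt_nonneg)
  also have "\<dots> \<le> real (card {p. prime p \<and> p \<le> n}) * ln (real n)"
    using assms by (intro sum_mangoldt_le) auto
  finally have "real k * ln 2 \<le> real (card {p. prime p \<and> p \<le> n}) * ln (real n)"
    by (simp add: ln_realpow)
  moreover have "real k * (2 / 3) \<le> real k * ln 2"
    by (intro mult_left_mono ln2_ge_two_thirds) auto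
  ultimately show ?thesis using k(3) assms by linarith
qed

section \<open>Duality with a Fejer kernel\<close>

text \<open>
The Fejer kernel of length \<open>2n\<close>, normalized so that its Fourier coefficients at \<open>1, \<dots>, n\<close> are at
least 1. It vanishes at every \<open>n\<close>-th root of unity other than 1, so distinct points of a grid do not
interact.
\<close>

definition fejer :: "nat \<Rightarrow> complex \<Rightarrow> real" where
  "fejer n \<zeta> = (norm (\<Sum>h<2*n. \<zeta> ^ h))\<^sup>2 / real n"

lemma fejer_nonneg: "fejer n \<zeta> \<ge> 0"
  by (simp add: fejer_def)

lemma fejer_le:
  assumes "norm \<zeta> = 1"
  shows "fejer n \<zeta> \<le> 4 * real n"
proof -
  have "norm (\<Sum>h<2*n. \<zeta> ^ h) \<le> (\<Sum>h<2*n. norm (\<zeta> ^ h))" by (rule norm_sum)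
  also have "\<dots> = 2 * real n" using assms by (simp add: norm_power)
  finally have "(norm (\<Sum>h<2*n. \<zeta> ^ h))\<^sup>2 \<le> (2 * real n)\<^sup>2" by (intro power_mono) auto
  then show ?thesis by (cases "n = 0") (auto simp: fejer_def divide_le_eq power2_eq_square)
qed

lemma fejer_far_le:
  assumes "norm \<zeta> = 1" "\<sigma> > 0" "norm (\<zeta> - 1) \<ge> \<sigma>"
  shows "fejer n \<zeta> \<le> 4 / (\<sigma>\<^sup>2 * real n)"
proof -
  have "\<zeta> \<noteq> 1" using assms by auto
  then have "(\<Sum>h<2*n. \<zeta> ^ h) = (\<zeta> ^ (2*n) - 1) / (\<zeta> - 1)" by (simp add: geometric_sum)
  then have "norm (\<Sum>h<2*n. \<zeta> ^ h) = norm (\<zeta> ^ (2*n) - 1) / norm (\<zeta> - 1)" by (simp add: norm_divide)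
  also have "\<dots> \<le> 2 / \<sigma>"
  proof (rule frac_le)
    have "norm (\<zeta> ^ (2*n) - 1) \<le> norm (\<zeta> ^ (2*n)) + norm (1::complex)" by (rule norm_triangle_ineq4)
    also have "\<dots> = 2" using assms(1) by (simp add: norm_power)
    finally show "norm (\<zeta> ^ (2*n) - 1) \<le> 2" .
  qed (use assms in auto)
  finally have "(norm (\<Sum>h<2*n. \<zeta> ^ h))\<^sup>2 \<le> (2 / \<sigma>)\<^sup>2" by (intro power_mono) auto
  then have "fejer n \<zeta> \<le> (2 / \<sigma>)\<^sup>2 / real n" unfolding fejer_def by (rule divide_right_mono) auto
  then show ?thesis by (simp add: power_divide)
qed

lemma fejer_root_of_unity:
  assumes "\<zeta> ^ n = 1" "\<zeta> \<noteq> 1"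
  shows "fejer n \<zeta> = 0"
  using assms by (simp add: fejer_def geometric_sum power_mult mult.commute[of 2 n] power2_eq_square)

text \<open>
The dual large sieve. The right-hand side comes from expanding
\<open>\<Sum> |\<Sum>\<^sub>y b\<^sub>y \<eta>\<^sub>y^(h-h')|\<^sup>2\<close> over \<open>h, h' < 2n\<close>; every difference \<open>k\<close> with \<open>1 \<le> k \<le> n\<close> occurs
for at least \<open>n\<close> pairs.
\<close>

lemma sum_norm_sq_le_fejer:
  fixes b \<eta> :: "'i \<Rightarrow> complex"
  assumes "finite Y" "n > 0" and \<eta>: "\<And>y. y \<in> Y \<Longrightarrow> norm (\<eta> y) = 1"
  shows "(\<Sum>k=1..n. (norm (\<Sum>y\<in>Y. b y * \<eta> y ^ k))\<^sup>2)
           \<le> (\<Sum>x\<in>Y. \<Sum>y\<in>Y. norm (b x) * norm (b y) * fejer n (\<eta> x * cnj (\<eta> y)))"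
proof -
  define g where "g = (\<lambda>h h'. \<Sum>y\<in>Y. b y * (\<eta> y ^ h * cnj (\<eta> y) ^ h'))"
  define D where "D = (\<lambda>\<zeta>::complex. \<Sum>h<2*n. \<zeta> ^ h)"
  have unit: "\<eta> y * cnj (\<eta> y) = 1" if "y \<in> Y" for y
    using \<eta>[OF that] by (simp add: complex_norm_square[symmetric])
  have "real n * (\<Sum>k=1..n. (norm (\<Sum>y\<in>Y. b y * \<eta> y ^ k))\<^sup>2)
      = (\<Sum>(k,h)\<in>{1..n}\<times>{..<n}. (norm (g (h + k) h))\<^sup>2)"
  proof -
    have "g (h + k) h = (\<Sum>y\<in>Y. b y * \<eta> y ^ k)" for h k
      unfolding g_def
    proof (intro sum.cong refl)
      fix y assume y: "y \<in> Y"
      have "\<eta> y ^ (h + k) * cnj (\<eta> y) ^ h = (\<eta> y * cnj (\<eta> y)) ^ h * \<eta> y ^ k"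
        by (simp add: power_add power_mult_distrib)
      then show "b y * (\<eta> y ^ (h + k) * cnj (\<eta> y) ^ h) = b y * \<eta> y ^ k"
        using unit[OF y] by simp
    qed
    then show ?thesis by (simp add: sum.cartesian_product[symmetric] sum_distrib_left)
  qed
  also have "\<dots> = (\<Sum>(h,h')\<in>(\<lambda>(k,h). (h + k, h)) ` ({1..n}\<times>{..<n}). (norm (g h h'))\<^sup>2)"
    by (subst sum.reindex) (auto simp: inj_on_def case_prod_unfold)
  also have "\<dots> \<le> (\<Sum>(h,h')\<in>{..<2*n}\<times>{..<2*n}. (norm (g h h'))\<^sup>2)"
    by (intro sum_mono2) auto
  also have "\<dots> = (\<Sum>h<2*n. \<Sum>h'<2*n. (norm (g h h'))\<^sup>2)"
    by (simp add: sum.cartesian_product)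
  also have "\<dots> = norm (complex_of_real (\<Sum>h<2*n. \<Sum>h'<2*n. (norm (g h h'))\<^sup>2))"
    by (simp only: norm_of_real) (simp add: sum_nonneg)
  also have "complex_of_real (\<Sum>h<2*n. \<Sum>h'<2*n. (norm (g h h'))\<^sup>2)
      = (\<Sum>h<2*n. \<Sum>h'<2*n. \<Sum>x\<in>Y. \<Sum>y\<in>Y. b x * cnj (b y) * ((\<eta> x * cnj (\<eta> y)) ^ h * (cnj (\<eta> x * cnj (\<eta> y))) ^ h'))"
    unfolding of_real_sum
  proof (intro sum.cong refl)
    fix h h'
    show "complex_of_real ((norm (g h h'))\<^sup>2)
      = (\<Sum>x\<in>Y. \<Sum>y\<in>Y. b x * cnj (b y) * ((\<eta> x * cnj (\<eta> y)) ^ h * (cnj (\<eta> x * cnj (\<eta> y))) ^ h'))"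
      unfolding complex_norm_square g_def cnj_sum sum_product
      by (intro sum.cong refl) (simp add: power_mult_distrib mult_ac)
  qed
  also have "\<dots> = (\<Sum>x\<in>Y. \<Sum>y\<in>Y. \<Sum>h<2*n. \<Sum>h'<2*n. b x * cnj (b y) * ((\<eta> x * cnj (\<eta> y)) ^ h * (cnj (\<eta> x * cnj (\<eta> y))) ^ h'))"
  proof -
    have "(\<Sum>h<2*n. \<Sum>h'<2*n. \<Sum>x\<in>Y. \<Sum>y\<in>Y. f h h' x y) = (\<Sum>x\<in>Y. \<Sum>y\<in>Y. \<Sum>h<2*n. \<Sum>h'<2*n. f h h' x y)"
      for f :: "nat \<Rightarrow> nat \<Rightarrow> 'i \<Rightarrow> 'i \<Rightarrow> complex"
    proof -
      have "(\<Sum>h<2*n. \<Sum>h'<2*n. \<Sum>x\<in>Y. \<Sum>y\<in>Y. f h h' x y)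
          = (\<Sum>h<2*n. \<Sum>x\<in>Y. \<Sum>h'<2*n. \<Sum>y\<in>Y. f h h' x y)"
        by (rule sum.cong[OF refl], rule sum.swap)
      also have "\<dots> = (\<Sum>x\<in>Y. \<Sum>h<2*n. \<Sum>h'<2*n. \<Sum>y\<in>Y. f h h' x y)"
        by (rule sum.swap)
      also have "\<dots> = (\<Sum>x\<in>Y. \<Sum>h<2*n. \<Sum>y\<in>Y. \<Sum>h'<2*n. f h h' x y)"
        by (rule sum.cong[OF refl], rule sum.cong[OF refl], rule sum.swap)
      also have "\<dots> = (\<Sum>x\<in>Y. \<Sum>y\<in>Y. \<Sum>h<2*n. \<Sum>h'<2*n. f h h' x y)"
        by (rule sum.cong[OF refl], rule sum.swap)
      finally show ?thesis .
    qed
    then show ?thesis .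
  qed
  also have "\<dots> = (\<Sum>x\<in>Y. \<Sum>y\<in>Y. b x * cnj (b y) * (D (\<eta> x * cnj (\<eta> y)) * cnj (D (\<eta> x * cnj (\<eta> y)))))"
  proof (intro sum.cong refl)
    fix x y
    have "D (\<eta> x * cnj (\<eta> y)) * cnj (D (\<eta> x * cnj (\<eta> y)))
        = (\<Sum>h<2*n. \<Sum>h'<2*n. (\<eta> x * cnj (\<eta> y)) ^ h * (cnj (\<eta> x * cnj (\<eta> y))) ^ h')"
      by (simp only: D_def cnj_sum complex_cnj_power sum_product)
    then show "(\<Sum>h<2*n. \<Sum>h'<2*n. b x * cnj (b y) * ((\<eta> x * cnj (\<eta> y)) ^ h * (cnj (\<eta> x * cnj (\<eta> y))) ^ h'))
        = b x * cnj (b y) * (D (\<eta> x * cnj (\<eta> y)) * cnj (D (\<eta> x * cnj (\<eta> y))))"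
      by (simp only: sum_distrib_left)
  qed
  also have "norm \<dots> \<le> (\<Sum>x\<in>Y. \<Sum>y\<in>Y. norm (b x) * norm (b y) * (norm (D (\<eta> x * cnj (\<eta> y))))\<^sup>2)"
    by (intro sum_norm_le) (simp add: norm_mult power2_eq_square)
  also have "\<dots> = real n * (\<Sum>x\<in>Y. \<Sum>y\<in>Y. norm (b x) * norm (b y) * fejer n (\<eta> x * cnj (\<eta> y)))"
    using assms(2) by (simp add: fejer_def D_def sum_distrib_left)
  finally show ?thesis using assms(2) by simp
qed

section \<open>Interaction of the rough Farey fractions\<close>

text \<open>
The fractions \<open>a/q\<close> with rough \<open>q \<le> z\<close>, each as a root of unity together with its order. The pair is
determined by its second component; keeping \<open>q\<close> gives access to the weight \<open>1/q\<close>.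
\<close>

definition farey :: "nat \<Rightarrow> nat \<Rightarrow> (nat \<times> complex) set" where
  "farey M z = Sigma (rough M z) primitive_roots"

definition rough_sum :: "nat \<Rightarrow> nat \<Rightarrow> real" where
  "rough_sum M z = (\<Sum>q\<in>rough M z. 1 / real q)"

lemma finite_farey [simp]: "finite (farey M z)"
  unfolding farey_def by (auto intro!: finite_SigmaI dest: rough_pos)

lemma rough_le: "q \<in> rough M z \<Longrightarrow> q \<le> z"
  by (simp add: rough_def squarefrees_def)

lemma fareyD:
  assumes "i \<in> farey M z"
  shows "fst i \<in> rough M z" "fst i > 0" "fst i \<le> z" "snd i \<in> primitive_roots (fst i)" "norm (snd i) = 1"
    "snd i ^ fst i = 1"
  using assms rough_pos[of "fst i" M z] rough_le[of "fst i" M z] norm_primitive_root[of "snd i" "fst i"]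
    primitive_rootsD[of "snd i" "fst i" "fst i"]
  by (auto simp: farey_def)

lemma farey_inj: "i \<in> farey M z \<Longrightarrow> j \<in> farey M z \<Longrightarrow> snd i = snd j \<Longrightarrow> i = j"
  using primitive_roots_order_unique[of "snd i" "fst i" "fst j"] fareyD(4)[of i] fareyD(4)[of j]
  by (auto simp: prod_eq_iff)

lemma sum_farey_multiples_le:
  assumes "P > 0"
  shows "(\<Sum>i\<in>{i\<in>farey M z. P dvd fst i}. (1 / real (fst i))\<^sup>2) \<le> rough_sum M z / real P"
proof -
  have "{i\<in>farey M z. P dvd fst i} = Sigma {q\<in>rough M z. P dvd q} primitive_roots"
    by (auto simp: farey_def)
  then have "(\<Sum>i\<in>{i\<in>farey M z. P dvd fst i}. (1 / real (fst i))\<^sup>2)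
      = (\<Sum>q\<in>{q\<in>rough M z. P dvd q}. \<Sum>\<omega>\<in>primitive_roots q. (1 / real q)\<^sup>2)"
    by (subst sum.Sigma) (auto simp: case_prod_unfold dest: rough_pos)
  also have "\<dots> \<le> (\<Sum>q\<in>{q\<in>rough M z. P dvd q}. 1 / real q)"
  proof (intro sum_mono)
    fix q assume "q \<in> {q\<in>rough M z. P dvd q}"
    then have q: "q > 0" by (auto dest: rough_pos)
    have "(\<Sum>\<omega>\<in>primitive_roots q. (1 / real q)\<^sup>2) = real (card (primitive_roots q)) * (1 / real q)\<^sup>2" by simp
    also have "\<dots> \<le> real q * (1 / real q)\<^sup>2"
      using card_primitive_roots_le[OF q] by (intro mult_right_mono) auto
    finally show "(\<Sum>\<omega>\<in>primitive_roots q. (1 / real q)\<^sup>2) \<le> 1 / real q"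
      using q by (simp add: power2_eq_square)
  qed
  also have "\<dots> \<le> (1 / real P) * (\<Sum>q\<in>rough M z. 1 / real q)"
    using assms by (intro sum_inverse_multiples_le) (auto intro: rough_pos rough_down)
  finally show ?thesis by (simp add: rough_sum_def)
qed

lemma sum_farey_squares_le: "(\<Sum>i\<in>farey M z. (1 / real (fst i))\<^sup>2) \<le> rough_sum M z"
  using sum_farey_multiples_le[of 1 M z] by simp

lemma sum_farey_le: "(\<Sum>i\<in>farey M z. 1 / real (fst i)) \<le> real z"
proof -
  have "(\<Sum>i\<in>farey M z. 1 / real (fst i)) = (\<Sum>q\<in>rough M z. \<Sum>\<omega>\<in>primitive_roots q. 1 / real q)"
    unfolding farey_def by (subst sum.Sigma) (auto simp: case_prod_unfold dest: rough_pos)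
  also have "\<dots> \<le> (\<Sum>q\<in>rough M z. 1)"
  proof (intro sum_mono)
    fix q assume "q \<in> rough M z"
    then have q: "q > 0" by (auto dest: rough_pos)
    then show "(\<Sum>\<omega>\<in>primitive_roots q. 1 / real q) \<le> 1"
      using card_primitive_roots_le[OF q] by (simp add: divide_le_eq)
  qed
  also have "\<dots> \<le> real (card {1..z})"
    by (simp, rule card_mono[of "{1..z}", simplified]) (auto simp: Suc_le_eq rough_pos rough_le)
  finally show ?thesis by simp
qed

text \<open>
The total interaction of the shifts of two points whose quotient is \<open>\<zeta>\<close>, with weight \<open>1/q\<close> for a shift of
order \<open>q\<close>. The weight \<open>1/q\<close> takes the place of the more common \<open>1/\<phi>(q)\<close>.
\<close>

definition farey_form :: "nat \<Rightarrow> nat \<Rightarrow> nat \<Rightarrow> complex \<Rightarrow> real" where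
  "farey_form n M z \<zeta> = (\<Sum>i\<in>farey M z. \<Sum>j\<in>farey M z.
      1 / real (fst i) * (1 / real (fst j)) * fejer n (\<zeta> * (snd i * cnj (snd j))))"

text \<open>
Two distinct quotients \<open>snd i * cnj (snd j)\<close> differ by at least \<open>1/z^4\<close>, as the quotient of the two is
a root of unity of order at most \<open>z^4\<close>. The threshold is half of this distance.
\<close>

definition near_pairs :: "nat \<Rightarrow> nat \<Rightarrow> complex \<Rightarrow> ((nat \<times> complex) \<times> (nat \<times> complex)) set" where
  "near_pairs M z \<zeta> = {(i, j) \<in> farey M z \<times> farey M z.
      norm (\<zeta> * (snd i * cnj (snd j)) - 1) < 1 / (2 * real z ^ 4)}"

lemma near_pairs_subset: "near_pairs M z \<zeta> \<subseteq> farey M z \<times> farey M z"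
  by (auto simp: near_pairs_def)

lemma finite_near_pairs [simp]: "finite (near_pairs M z \<zeta>)"
  by (rule finite_subset[OF near_pairs_subset]) simp

text \<open>
Two quotients that both nearly cancel \<open>\<zeta>\<close> are close to each other, and as roots of unity of small order
they must then coincide. So only one fraction is responsible for the whole near part of the interaction.
\<close>

lemma near_pairs_same_ratio:
  assumes "norm \<zeta> = 1" "(i, j) \<in> near_pairs M z \<zeta>" "(k, l) \<in> near_pairs M z \<zeta>"
  shows "snd i * cnj (snd j) = snd k * cnj (snd l)"
proof (rule ccontr)
  define \<alpha> where "\<alpha> = snd i * cnj (snd j)"
  define \<beta> where "\<beta> = snd k * cnj (snd l)"
  assume "snd i * cnj (snd j) \<noteq> snd k * cnj (snd l)"
  then have ne: "\<alpha> \<noteq> \<beta>" by (simp add: \<alpha>_def \<beta>_def)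
  have mem: "i \<in> farey M z" "j \<in> farey M z" "k \<in> farey M z" "l \<in> farey M z"
    using assms by (auto simp: near_pairs_def)
  have near: "norm (\<zeta> * \<alpha> - 1) < 1 / (2 * real z ^ 4)" "norm (\<zeta> * \<beta> - 1) < 1 / (2 * real z ^ 4)"
    using assms by (auto simp: near_pairs_def \<alpha>_def \<beta>_def)
  have nb: "norm \<beta> = 1" using mem by (simp add: \<beta>_def norm_mult fareyD)
  then have bb: "\<beta> * cnj \<beta> = 1" by (simp add: complex_norm_square[symmetric])
  define D where "D = fst i * fst j * fst k * fst l"
  have D0: "D > 0" using mem by (simp add: D_def fareyD)
  have pw: "snd a ^ D = 1" if "a \<in> {i, j, k, l}" for a
  proof -
    have "fst a dvd D" using that by (auto simp: D_def)
    then show ?thesis using that mem primitive_rootsD[of "snd a" "fst a" D] fareyD(4)[of a M z] by auto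
  qed
  have "D \<le> z * z * z * z" unfolding D_def using mem by (intro mult_mono) (auto simp: fareyD)
  then have "real D \<le> real (z * z * z * z)" by (simp only: of_nat_le_iff)
  then have Dz: "real D \<le> real z ^ 4" by (simp add: power4_eq_xxxx)
  have "norm (\<alpha> * cnj \<beta> - 1) = norm (\<alpha> - \<beta>)"
  proof -
    have "\<alpha> * cnj \<beta> - 1 = (\<alpha> - \<beta>) * cnj \<beta>" using bb by (simp add: algebra_simps)
    then show ?thesis using nb by (simp add: norm_mult)
  qed
  also have "\<dots> = norm ((\<zeta> * \<alpha> - 1) - (\<zeta> * \<beta> - 1))"
    using assms(1) by (simp add: norm_mult flip: right_diff_distrib)
  also have "\<dots> \<le> norm (\<zeta> * \<alpha> - 1) + norm (\<zeta> * \<beta> - 1)" by (rule norm_triangle_ineq4)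
  also have "\<dots> < 1 / real z ^ 4" using near by simp
  finally have lt: "norm (\<alpha> * cnj \<beta> - 1) < 1 / real z ^ 4" .
  have "(\<alpha> * cnj \<beta>) ^ D = 1"
    by (simp add: \<alpha>_def \<beta>_def power_mult_distrib pw flip: complex_cnj_power)
  moreover have "\<alpha> * cnj \<beta> \<noteq> 1"
  proof
    assume "\<alpha> * cnj \<beta> = 1"
    then have "\<alpha> * (\<beta> * cnj \<beta>) = \<beta>" by (simp add: mult_ac)
    then show False using bb ne by simp
  qed
  ultimately have "1 \<le> real D * norm (\<alpha> * cnj \<beta> - 1)"
    using root_of_unity_distance_1 D0 by blast
  also have "\<dots> \<le> real z ^ 4 * norm (\<alpha> * cnj \<beta> - 1)" using Dz by (intro mult_right_mono) auto
  also have "\<dots> < 1"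
  proof -
    have "real z ^ 4 > 0" using D0 Dz by linarith
    then show ?thesis using lt by (simp add: less_divide_eq mult.commute)
  qed
  finally show False by simp
qed

text \<open>
Away from 1 the Fejer kernel decays, so for \<open>z\<close> a small power of \<open>n\<close> all pairs that are not near
contribute a negligible amount.
\<close>

lemma farey_form_le_near:
  assumes "norm \<zeta> = 1" "z > 0" "n > 0"
  shows "farey_form n M z \<zeta> \<le> (\<Sum>(i,j)\<in>near_pairs M z \<zeta>.
      1 / real (fst i) * (1 / real (fst j)) * fejer n (\<zeta> * (snd i * cnj (snd j)))) + 16 * real z ^ 10 / real n"
proof -
  let ?F = "farey M z \<times> farey M z" and ?N = "near_pairs M z \<zeta>"
  define f where "f = (\<lambda>(i::nat\<times>complex,j::nat\<times>complex).
      1 / real (fst i) * (1 / real (fst j)) * fejer n (\<zeta> * (snd i * cnj (snd j))))"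
  have "farey_form n M z \<zeta> = (\<Sum>x\<in>?F. f x)"
    by (simp add: farey_form_def f_def sum.cartesian_product)
  also have "\<dots> = (\<Sum>x\<in>?F - ?N. f x) + (\<Sum>x\<in>?N. f x)"
    using near_pairs_subset by (intro sum.subset_diff) auto
  also have "(\<Sum>x\<in>?F - ?N. f x) \<le> (\<Sum>(i,j)\<in>?F - ?N. 1 / real (fst i) * (1 / real (fst j)) * (16 * real z ^ 8 / real n))"
  proof (intro sum_mono)
    fix x assume x: "x \<in> ?F - ?N"
    obtain i j where ij: "x = (i, j)" by (cases x)
    have mem: "i \<in> farey M z" "j \<in> farey M z" using x ij by auto
    have "fejer n (\<zeta> * (snd i * cnj (snd j))) \<le> 4 / ((1 / (2 * real z ^ 4))\<^sup>2 * real n)"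
      using x ij mem assms by (intro fejer_far_le) (auto simp: near_pairs_def norm_mult fareyD)
    also have "\<dots> = 16 * real z ^ 8 / real n"
      using assms by (simp add: power_divide power_mult_distrib flip: power_mult)
    finally have "fejer n (\<zeta> * (snd i * cnj (snd j))) \<le> 16 * real z ^ 8 / real n" .
    then show "f x \<le> (case x of (i,j) \<Rightarrow> 1 / real (fst i) * (1 / real (fst j)) * (16 * real z ^ 8 / real n))"
      unfolding ij f_def prod.case by (rule mult_left_mono) auto
  qed
  also have "\<dots> \<le> (\<Sum>(i,j)\<in>?F. 1 / real (fst i) * (1 / real (fst j)) * (16 * real z ^ 8 / real n))"
    by (intro sum_mono2) auto
  also have "\<dots> = (\<Sum>i\<in>farey M z. 1 / real (fst i)) * (\<Sum>j\<in>farey M z. 1 / real (fst j)) * (16 * real z ^ 8 / real n)"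
  proof -
    have "(\<Sum>(i,j)\<in>?F. 1 / real (fst i) * (1 / real (fst j)) * (16 * real z ^ 8 / real n))
        = (\<Sum>(i,j)\<in>?F. 1 / real (fst i) * (1 / real (fst j))) * (16 * real z ^ 8 / real n)"
      by (simp only: sum_distrib_right case_prod_unfold)
    also have "(\<Sum>(i,j)\<in>?F. 1 / real (fst i) * (1 / real (fst j)))
        = (\<Sum>i\<in>farey M z. 1 / real (fst i)) * (\<Sum>j\<in>farey M z. 1 / real (fst j))"
      by (simp only: sum_product sum.cartesian_product)
    finally show ?thesis .
  qed
  also have "\<dots> \<le> real z * real z * (16 * real z ^ 8 / real n)"
    by (intro mult_right_mono mult_mono sum_farey_le sum_nonneg) auto
  also have "\<dots> = 16 * real z ^ 10 / real n" by (simp add: eval_nat_numeral)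
  finally show ?thesis by (simp add: f_def)
qed

lemma near_diagonal_le:
  assumes "\<And>i j. (i, j) \<in> near_pairs M z \<zeta> \<Longrightarrow> i = j"
  shows "(\<Sum>(i,j)\<in>near_pairs M z \<zeta>.
      1 / real (fst i) * (1 / real (fst j)) * fejer n (\<zeta> * (snd i * cnj (snd j)))) \<le> fejer n \<zeta> * rough_sum M z"
proof -
  let ?N = "near_pairs M z \<zeta>"
  have "(\<Sum>(i,j)\<in>?N. 1 / real (fst i) * (1 / real (fst j)) * fejer n (\<zeta> * (snd i * cnj (snd j))))
      = (\<Sum>x\<in>?N. (1 / real (fst (fst x)))\<^sup>2 * fejer n \<zeta>)"
  proof (intro sum.cong refl)
    fix x assume x: "x \<in> ?N"
    obtain i j where ij: "x = (i, j)" by (cases x)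
    then have "i = j" "i \<in> farey M z" using assms x near_pairs_subset[of M z \<zeta>] by auto
    moreover from this have "snd i * cnj (snd i) = 1"
      by (simp add: fareyD flip: complex_norm_square)
    ultimately show "(case x of (i, j) \<Rightarrow> 1 / real (fst i) * (1 / real (fst j)) * fejer n (\<zeta> * (snd i * cnj (snd j))))
       = (1 / real (fst (fst x)))\<^sup>2 * fejer n \<zeta>" using ij by (simp add: power2_eq_square)
  qed
  also have "\<dots> \<le> (\<Sum>i\<in>farey M z. (1 / real (fst i))\<^sup>2 * fejer n \<zeta>)"
  proof (rule sum_le_included[where i = "\<lambda>i. (i, i)"])
    show "\<forall>x\<in>?N. \<exists>i\<in>farey M z. (i, i) = x \<and> (1 / real (fst (fst x)))\<^sup>2 * fejer n \<zeta> \<le> (1 / real (fst i))\<^sup>2 * fejer n \<zeta>"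
      using assms near_pairs_subset by fastforce
  qed (auto simp: fejer_nonneg)
  also have "\<dots> = (\<Sum>i\<in>farey M z. (1 / real (fst i))\<^sup>2) * fejer n \<zeta>" by (simp add: sum_distrib_right)
  also have "\<dots> \<le> rough_sum M z * fejer n \<zeta>"
    by (intro mult_right_mono sum_farey_squares_le fejer_nonneg)
  finally show ?thesis by (simp add: mult.commute)
qed

text \<open>
Since the quotient of a near pair is fixed, each member determines the other. Splitting the products
of the weights by the inequality of the means reduces the sum to sums of squares of single weights, one of
them restricted to multiples of \<open>P\<close>, which saves a factor \<open>1/P\<close>. The inequality is balanced so that for
\<open>P \<ge> 4 t\<^sup>2\<close> both halves are equally large.
\<close>

lemma sum_near_weights_le:
  assumes "norm \<zeta> = 1" "t > 0" "P > 0" "4 * t\<^sup>2 \<le> real P"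
    and dvd: "\<And>i j. (i, j) \<in> near_pairs M z \<zeta> \<Longrightarrow> P dvd fst i \<or> P dvd fst j"
  shows "(\<Sum>(i,j)\<in>near_pairs M z \<zeta>. 1 / real (fst i) * (1 / real (fst j))) \<le> rough_sum M z / t"
proof -
  let ?N = "near_pairs M z \<zeta>" and ?G = "rough_sum M z"
  let ?v = "\<lambda>i::nat\<times>complex. 1 / real (fst i)"
  have amgm: "a * b \<le> t * a\<^sup>2 + b\<^sup>2 / (4 * t)" for a b :: real
  proof -
    have "0 \<le> (2 * t * a - b)\<^sup>2 / (4 * t)" using assms(2) by simp
    also have "\<dots> = t * a\<^sup>2 + b\<^sup>2 / (4 * t) - a * b"
      using assms(2) by (simp add: power2_eq_square field_simps)
    finally show ?thesis by simp
  qed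
  have G0: "?G \<ge> 0" by (simp add: rough_sum_def sum_nonneg)
  have unit: "snd i * cnj (snd i) = 1" if "i \<in> farey M z" for i
    using that by (simp add: fareyD flip: complex_norm_square)
  have inj1: "inj_on fst ?N"
  proof (rule inj_onI)
    fix x y assume x: "x \<in> ?N" and y: "y \<in> ?N" and eq: "fst x = fst y"
    obtain i j k where ij: "x = (i, j)" "y = (i, k)" using eq by (metis prod.collapse)
    have mem: "i \<in> farey M z" "j \<in> farey M z" "k \<in> farey M z" using x y ij near_pairs_subset by auto
    have "snd i * cnj (snd j) = snd i * cnj (snd k)" using near_pairs_same_ratio assms(1) x y ij by metis
    then have "snd j = snd k" using unit[OF mem(1)] by auto
    then show "x = y" using farey_inj mem ij by metis
  qed
  have inj2: "inj_on snd ?N"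
  proof (rule inj_onI)
    fix x y assume x: "x \<in> ?N" and y: "y \<in> ?N" and eq: "snd x = snd y"
    obtain i j k where ij: "x = (j, i)" "y = (k, i)" using eq by (metis prod.collapse)
    have mem: "i \<in> farey M z" "j \<in> farey M z" "k \<in> farey M z" using x y ij near_pairs_subset by auto
    have "snd j * cnj (snd i) = snd k * cnj (snd i)" using near_pairs_same_ratio assms(1) x y ij by metis
    then have "snd j = snd k" using unit[OF mem(1)] by auto
    then show "x = y" using farey_inj mem ij by metis
  qed
  have proj: "(\<Sum>x\<in>A. ?v (\<pi> x) ^ 2) \<le> (\<Sum>i\<in>B. ?v i ^ 2)"
    if "A \<subseteq> ?N" "inj_on \<pi> ?N" "\<pi> ` A \<subseteq> B" "finite B" for A B \<pi>
  proof -
    have "(\<Sum>x\<in>A. ?v (\<pi> x) ^ 2) = (\<Sum>i\<in>\<pi> ` A. ?v i ^ 2)"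
      using inj_on_subset[OF that(2,1)] by (simp add: sum.reindex)
    also have "\<dots> \<le> (\<Sum>i\<in>B. ?v i ^ 2)" using that by (intro sum_mono2) auto
    finally show ?thesis .
  qed
  have Pbound: "t * (?G / real P) \<le> ?G / (4 * t)"
  proof -
    have "t * (?G / real P) \<le> t * (?G / (4 * t\<^sup>2))"
      using assms G0 by (intro mult_left_mono divide_left_mono) auto
    also have "\<dots> = ?G / (4 * t)" using assms(2) by (simp add: power2_eq_square)
    finally show ?thesis .
  qed
  have half: "(\<Sum>x\<in>A. ?v (\<pi> x) * ?v (\<pi>' x)) \<le> ?G / (2 * t)"
    if A: "A \<subseteq> ?N" and inj: "inj_on \<pi> ?N" "inj_on \<pi>' ?N"
      and im: "\<pi> ` A \<subseteq> {i\<in>farey M z. P dvd fst i}" "\<pi>' ` A \<subseteq> farey M z" for A \<pi> \<pi>'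
  proof -
    have "(\<Sum>x\<in>A. ?v (\<pi> x) * ?v (\<pi>' x)) \<le> (\<Sum>x\<in>A. t * ?v (\<pi> x) ^ 2 + ?v (\<pi>' x) ^ 2 / (4 * t))"
      by (intro sum_mono amgm)
    also have "\<dots> = t * (\<Sum>x\<in>A. ?v (\<pi> x) ^ 2) + (\<Sum>x\<in>A. ?v (\<pi>' x) ^ 2) / (4 * t)"
      by (simp add: sum.distrib sum_distrib_left sum_divide_distrib)
    also have "\<dots> \<le> t * (\<Sum>i\<in>{i\<in>farey M z. P dvd fst i}. ?v i ^ 2) + (\<Sum>i\<in>farey M z. ?v i ^ 2) / (4 * t)"
      using assms(2) by (intro add_mono mult_left_mono divide_right_mono proj A inj im) auto
    also have "\<dots> \<le> t * (?G / real P) + ?G / (4 * t)"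
      using assms(2,3) by (intro add_mono mult_left_mono divide_right_mono sum_farey_multiples_le sum_farey_squares_le) auto
    also have "\<dots> \<le> ?G / (2 * t)" using Pbound by simp
    finally show ?thesis .
  qed
  let ?A = "{x\<in>?N. P dvd fst (fst x)}" and ?B = "{x\<in>?N. \<not> P dvd fst (fst x)}"
  have "(\<Sum>(i,j)\<in>?N. ?v i * ?v j) = (\<Sum>x\<in>?A \<union> ?B. ?v (fst x) * ?v (snd x))"
    by (intro sum.cong) auto
  also have "\<dots> = (\<Sum>x\<in>?A. ?v (fst x) * ?v (snd x)) + (\<Sum>x\<in>?B. ?v (snd x) * ?v (fst x))"
    by (subst sum.union_disjoint) (auto simp: mult.commute)
  also have "\<dots> \<le> ?G / (2 * t) + ?G / (2 * t)"
  proof (intro add_mono half inj1 inj2)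
    show "snd ` ?B \<subseteq> {i\<in>farey M z. P dvd fst i}"
    proof (rule image_subsetI)
      fix x assume x: "x \<in> ?B"
      then have "P dvd fst (snd x)" using dvd[of "fst x" "snd x"] by simp
      then show "snd x \<in> {i\<in>farey M z. P dvd fst i}"
        using x near_pairs_subset[of M z \<zeta>] by auto
    qed
  qed (use near_pairs_subset[of M z \<zeta>] in auto)
  finally show ?thesis by simp
qed

text \<open>
If the common quotient \<open>\<rho>\<close> of the near pairs is not 1, a prime \<open>P\<close> dividing its order divides one of the
two orders in every near pair. These orders are rough, so \<open>P\<close> exceeds \<open>M\<close>.
\<close>

lemma near_off_diagonal_le:
  assumes "norm \<zeta> = 1" "t > 0" "4 * t\<^sup>2 \<le> real M"
    and pair: "(i0, j0) \<in> near_pairs M z \<zeta>" "i0 \<noteq> j0"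
  shows "(\<Sum>(i,j)\<in>near_pairs M z \<zeta>.
      1 / real (fst i) * (1 / real (fst j)) * fejer n (\<zeta> * (snd i * cnj (snd j)))) \<le> 4 * real n * (rough_sum M z / t)"
proof -
  let ?N = "near_pairs M z \<zeta>"
  define \<rho> where "\<rho> = snd i0 * cnj (snd j0)"
  have mem0: "i0 \<in> farey M z" "j0 \<in> farey M z" using pair near_pairs_subset by auto
  have ratio: "snd i * cnj (snd j) = \<rho>" if "(i, j) \<in> ?N" for i j
    unfolding \<rho>_def using near_pairs_same_ratio assms(1) that pair(1) by blast
  have pw: "\<rho> ^ (fst i * fst j) = 1" if "(i, j) \<in> ?N" for i j
  proof -
    have mem: "i \<in> farey M z" "j \<in> farey M z" using that near_pairs_subset by auto
    have "snd i ^ (fst i * fst j) = 1" "snd j ^ (fst i * fst j) = 1"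
      using primitive_rootsD[OF fareyD(4)[OF mem(1)]] primitive_rootsD[OF fareyD(4)[OF mem(2)]] by auto
    then show ?thesis by (simp add: power_mult_distrib flip: ratio[OF that] complex_cnj_power)
  qed
  have "\<rho> \<noteq> 1"
  proof
    assume "\<rho> = 1"
    moreover have "snd j0 * cnj (snd j0) = 1" using mem0 by (simp add: fareyD flip: complex_norm_square)
    ultimately have "snd i0 = snd j0" unfolding \<rho>_def
      by (metis mult.assoc mult.commute mult_1)
    then show False using farey_inj mem0 pair(2) by blast
  qed
  obtain d where d: "\<rho> \<in> primitive_roots d" "d dvd fst i0 * fst j0"
    using ex_primitive_order[OF pw[OF pair(1)]] mem0 by (auto simp: fareyD)
  have "d \<noteq> 1" using primitive_rootsD[OF d(1), of 1] \<open>\<rho> \<noteq> 1\<close> by auto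
  then obtain P where P: "prime P" "P dvd d" using prime_factor_nat by blast
  have "P dvd fst i0 * fst j0" using P d by (meson dvd_trans)
  then have "P dvd fst i0 \<or> P dvd fst j0" using P(1) by (simp add: prime_dvd_mult_iff)
  then have "M < P" using P(1) mem0 fareyD(1)[of i0] fareyD(1)[of j0] by (auto simp: rough_def)
  have dvd: "P dvd fst i \<or> P dvd fst j" if "(i, j) \<in> ?N" for i j
  proof -
    have "d dvd fst i * fst j" using pw[OF that] primitive_rootsD[OF d(1)] by blast
    then show ?thesis using P by (meson dvd_trans prime_dvd_mult_iff)
  qed
  have "(\<Sum>(i,j)\<in>?N. 1 / real (fst i) * (1 / real (fst j)) * fejer n (\<zeta> * (snd i * cnj (snd j))))
      \<le> (\<Sum>(i,j)\<in>?N. 4 * real n * (1 / real (fst i) * (1 / real (fst j))))"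
  proof (intro sum_mono)
    fix x assume x: "x \<in> ?N"
    obtain i j where ij: "x = (i, j)" by (cases x)
    have "fejer n (\<zeta> * (snd i * cnj (snd j))) \<le> 4 * real n"
      using x ij near_pairs_subset assms(1) by (intro fejer_le) (auto simp: norm_mult fareyD dest!: subsetD[OF near_pairs_subset])
    then have "1 / real (fst i) * (1 / real (fst j)) * fejer n (\<zeta> * (snd i * cnj (snd j)))
       \<le> 1 / real (fst i) * (1 / real (fst j)) * (4 * real n)" by (intro mult_left_mono) auto
    then show "(case x of (i, j) \<Rightarrow> 1 / real (fst i) * (1 / real (fst j)) * fejer n (\<zeta> * (snd i * cnj (snd j))))
       \<le> (case x of (i, j) \<Rightarrow> 4 * real n * (1 / real (fst i) * (1 / real (fst j))))"
      using ij by (simp add: mult_ac)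
  qed
  also have "\<dots> = 4 * real n * (\<Sum>(i,j)\<in>?N. 1 / real (fst i) * (1 / real (fst j)))"
    by (simp only: sum_distrib_left case_prod_unfold)
  also have "\<dots> \<le> 4 * real n * (rough_sum M z / t)"
    using assms \<open>M < P\<close> dvd by (intro mult_left_mono sum_near_weights_le[where P = P]) auto
  finally show ?thesis .
qed

text \<open>
For \<open>\<zeta> = 1\<close> every diagonal pair is near, so the common quotient of all near pairs is 1 and only the
diagonal contributes.
\<close>

lemma farey_form_1_le:
  assumes "z > 0" "n > 0"
  shows "farey_form n M z 1 \<le> 4 * real n * rough_sum M z + 16 * real z ^ 10 / real n"
proof -
  have diag: "i = j" if "(i, j) \<in> near_pairs M z 1" for i j
  proof -
    have mem: "i \<in> farey M z" "j \<in> farey M z" using that near_pairs_subset by auto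
    have "snd j * cnj (snd j) = 1" using mem by (simp add: fareyD flip: complex_norm_square)
    then have "(j, j) \<in> near_pairs M z 1" using mem assms by (simp add: near_pairs_def)
    then have "snd i * cnj (snd j) = snd j * cnj (snd j)"
      using near_pairs_same_ratio[of 1 i j M z j j] that by simp
    moreover have "cnj (snd j) \<noteq> 0" using \<open>snd j * cnj (snd j) = 1\<close> by auto
    ultimately have "snd i = snd j" by (simp only: mult_cancel_right) simp
    then show "i = j" using farey_inj mem by blast
  qed
  have G0: "rough_sum M z \<ge> 0" by (simp add: rough_sum_def sum_nonneg)
  show ?thesis
    using farey_form_le_near[of 1 z n M] near_diagonal_le[of M z 1 n, OF diag]
      mult_right_mono[OF fejer_le[of 1 n] G0] assms by simp
qed

text \<open>
Different points of the grid: either all near pairs are diagonal, and the kernel vanishes on the grid,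
or they share a nontrivial quotient, and roughness saves the factor \<open>1/t\<close>.
\<close>

lemma farey_form_root_of_unity_le:
  assumes "z > 0" "n > 0" "\<zeta> ^ n = 1" "\<zeta> \<noteq> 1" "t > 0" "4 * t\<^sup>2 \<le> real M"
  shows "farey_form n M z \<zeta> \<le> 4 * real n * (rough_sum M z / t) + 16 * real z ^ 10 / real n"
proof -
  have norm: "norm \<zeta> = 1" using root_of_unity_norm assms by blast
  have G0: "rough_sum M z \<ge> 0" by (simp add: rough_sum_def sum_nonneg)
  show ?thesis
  proof (cases "\<forall>i j. (i, j) \<in> near_pairs M z \<zeta> \<longrightarrow> i = j")
    case True
    have "0 \<le> 4 * real n * (rough_sum M z / t)" using G0 assms by simp
    then show ?thesis
      using farey_form_le_near[OF norm assms(1,2), of M] near_diagonal_le[of M z \<zeta> n] True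
        fejer_root_of_unity[OF assms(3,4)] by simp
  next
    case False
    then obtain i j where "(i, j) \<in> near_pairs M z \<zeta>" "i \<noteq> j" by blast
    then show ?thesis
      using farey_form_le_near[OF norm assms(1,2), of M] near_off_diagonal_le[OF norm assms(5,6), of i j z n]
      by linarith
  qed
qed

section \<open>The large sieve beyond the sifting limit\<close>

text \<open>
The identity \<open>c(q) U(x) = \<Sum>\<^sub>\<omega> U(x\<omega>)\<close> over the primitive \<open>q\<close>-th roots, multiplied by \<open>c(q)/q\<close> and summed
over \<open>q\<close>. The factor \<open>rough_sum\<close> gained on the left is what makes the large sieve sensitive to primes.
\<close>

lemma rough_sum_mult_exp_sum:
  fixes u :: "nat \<Rightarrow> complex"
  assumes cop: "\<And>p q. p \<in> A \<Longrightarrow> q \<in> rough M z \<Longrightarrow> coprime p q"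
  shows "complex_of_real (rough_sum M z) * (\<Sum>p\<in>A. u p * x ^ p)
    = (\<Sum>i\<in>farey M z. complex_of_real (1 / real (fst i)) * primitive_root_sum (fst i) * (\<Sum>p\<in>A. u p * (x * snd i) ^ p))"
proof -
  have one: "(\<Sum>\<omega>\<in>primitive_roots q. \<Sum>p\<in>A. u p * (x * \<omega>) ^ p) = primitive_root_sum q * (\<Sum>p\<in>A. u p * x ^ p)"
    if q: "q \<in> rough M z" for q
  proof -
    have "(\<Sum>\<omega>\<in>primitive_roots q. \<Sum>p\<in>A. u p * (x * \<omega>) ^ p) = (\<Sum>p\<in>A. \<Sum>\<omega>\<in>primitive_roots q. u p * (x * \<omega>) ^ p)"
      by (rule sum.swap)
    also have "\<dots> = (\<Sum>p\<in>A. u p * x ^ p * (\<Sum>\<omega>\<in>primitive_roots q. \<omega> ^ p))"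
      by (simp add: sum_distrib_left power_mult_distrib mult.assoc)
    also have "\<dots> = (\<Sum>p\<in>A. u p * x ^ p * primitive_root_sum q)"
      using cop q rough_pos by (intro sum.cong refl) (simp add: sum_primitive_roots_power)
    finally show ?thesis by (simp add: sum_distrib_left mult_ac)
  qed
  have "(\<Sum>i\<in>farey M z. complex_of_real (1 / real (fst i)) * primitive_root_sum (fst i) * (\<Sum>p\<in>A. u p * (x * snd i) ^ p))
     = (\<Sum>q\<in>rough M z. \<Sum>\<omega>\<in>primitive_roots q. complex_of_real (1 / real q) * primitive_root_sum q * (\<Sum>p\<in>A. u p * (x * \<omega>) ^ p))"
    unfolding farey_def by (subst sum.Sigma) (auto simp: case_prod_unfold dest: rough_pos)
  also have "\<dots> = (\<Sum>q\<in>rough M z. complex_of_real (1 / real q) * (\<Sum>p\<in>A. u p * x ^ p))"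
  proof (intro sum.cong refl)
    fix q assume q: "q \<in> rough M z"
    then have "primitive_root_sum q * primitive_root_sum q = 1"
      using primitive_root_sum_squarefree[of q] by (auto simp: rough_def squarefrees_def)
    then have "complex_of_real (1 / real q) * primitive_root_sum q * (primitive_root_sum q * (\<Sum>p\<in>A. u p * x ^ p))
       = complex_of_real (1 / real q) * (\<Sum>p\<in>A. u p * x ^ p)"
      by (simp add: mult.assoc)
    then show "(\<Sum>\<omega>\<in>primitive_roots q. complex_of_real (1 / real q) * primitive_root_sum q * (\<Sum>p\<in>A. u p * (x * \<omega>) ^ p))
       = complex_of_real (1 / real q) * (\<Sum>p\<in>A. u p * x ^ p)"
      unfolding sum_distrib_left[symmetric] one[OF q] .
  qed
  finally show ?thesis by (simp add: rough_sum_def sum_distrib_right)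
qed

text \<open>
Pair the previous identity with the complex conjugates of the values \<open>U(x)\<close> and apply the Cauchy-Schwarz
inequality in the frequency \<open>p\<close>. The remaining dual sum is a quadratic form in the \<open>|U(x)|\<close> whose
diagonal entries are about \<open>4 n G\<close> and whose other entries are smaller by the factor \<open>card X\<close>, so
that each row sum is about \<open>8 n G\<close>.
\<close>

lemma large_sieve_rough:
  fixes u :: "nat \<Rightarrow> complex"
  assumes n: "n > 0" and z: "z > 0" and X: "X \<subseteq> {x. x ^ n = 1}" "finite X" "X \<noteq> {}"
    and M: "4 * (real (card X))\<^sup>2 \<le> real M"
    and A: "A \<subseteq> {1..n}" and cop: "\<And>p q. p \<in> A \<Longrightarrow> q \<in> rough M z \<Longrightarrow> coprime p q"
  shows "(rough_sum M z)\<^sup>2 * (\<Sum>x\<in>X. (norm (\<Sum>p\<in>A. u p * x ^ p))\<^sup>2)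
    \<le> (\<Sum>p\<in>A. (norm (u p))\<^sup>2) * (8 * real n * rough_sum M z + (real (card X) + 1) * (16 * real z ^ 10 / real n))"
proof -
  define U where "U = (\<lambda>x. \<Sum>p\<in>A. u p * x ^ p)"
  define Z where "Z = (\<Sum>x\<in>X. (norm (U x))\<^sup>2)"
  define G where "G = rough_sum M z"
  define m where "m = real (card X)"
  define F where "F = 16 * real z ^ 10 / real n"
  define B where "B = 8 * real n * G + (m + 1) * F"
  define b where "b = (\<lambda>(x, i::nat \<times> complex). cnj (U x) * (complex_of_real (1 / real (fst i)) * primitive_root_sum (fst i)))"
  define \<eta> where "\<eta> = (\<lambda>(x, i::nat \<times> complex). x * snd i)"
  define Y where "Y = X \<times> farey M z"
  define W where "W = (\<lambda>k. \<Sum>y\<in>Y. b y * \<eta> y ^ k)"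
  have finA: "finite A" using A finite_subset by blast
  have finY: "finite Y" using X by (simp add: Y_def)
  have G0: "G \<ge> 0" by (simp add: G_def rough_sum_def sum_nonneg)
  have m1: "m \<ge> 1" using X by (simp add: m_def Suc_le_eq card_gt_0_iff)
  have Z0: "Z \<ge> 0" by (simp add: Z_def sum_nonneg)
  have F0: "F \<ge> 0" by (simp add: F_def)
  have normX: "norm x = 1" if "x \<in> X" for x using root_of_unity_norm[of x n] X that n by blast
  have GU: "complex_of_real G * U x = (\<Sum>i\<in>farey M z. complex_of_real (1 / real (fst i)) * primitive_root_sum (fst i) * (\<Sum>p\<in>A. u p * (x * snd i) ^ p))" for x
    unfolding U_def G_def by (rule rough_sum_mult_exp_sum[OF cop])
  have "complex_of_real (G * Z) = (\<Sum>x\<in>X. cnj (U x) * (complex_of_real G * U x))"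
    unfolding Z_def sum_distrib_left of_real_sum of_real_mult complex_norm_square by (simp add: mult_ac)
  also have "\<dots> = (\<Sum>x\<in>X. \<Sum>i\<in>farey M z. cnj (U x) * (complex_of_real (1 / real (fst i)) * primitive_root_sum (fst i) * (\<Sum>p\<in>A. u p * (x * snd i) ^ p)))"
    by (simp only: GU sum_distrib_left)
  also have "\<dots> = (\<Sum>y\<in>Y. b y * (\<Sum>p\<in>A. u p * \<eta> y ^ p))"
    unfolding Y_def b_def \<eta>_def by (simp add: sum.cartesian_product case_prod_unfold mult.assoc)
  also have "\<dots> = (\<Sum>p\<in>A. u p * W p)"
  proof -
    have "(\<Sum>y\<in>Y. b y * (\<Sum>p\<in>A. u p * \<eta> y ^ p)) = (\<Sum>y\<in>Y. \<Sum>p\<in>A. u p * (b y * \<eta> y ^ p))"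
      by (simp add: sum_distrib_left mult_ac)
    also have "\<dots> = (\<Sum>p\<in>A. \<Sum>y\<in>Y. u p * (b y * \<eta> y ^ p))" by (rule sum.swap)
    finally show ?thesis by (simp add: W_def sum_distrib_left)
  qed
  finally have dual: "complex_of_real (G * Z) = (\<Sum>p\<in>A. u p * W p)" .
  have "G * Z = norm (complex_of_real (G * Z))" using G0 Z0 by (simp del: of_real_mult)
  also have "\<dots> \<le> (\<Sum>p\<in>A. norm (u p) * norm (W p))"
    unfolding dual by (intro sum_norm_le) (simp add: norm_mult)
  finally have "(G * Z)\<^sup>2 \<le> (\<Sum>p\<in>A. norm (u p) * norm (W p))\<^sup>2"
    using G0 Z0 by (intro power_mono) auto
  also have "\<dots> \<le> (\<Sum>p\<in>A. (norm (u p))\<^sup>2) * (\<Sum>p\<in>A. (norm (W p))\<^sup>2)"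
    by (rule Cauchy_Schwarz_ineq_sum)
  also have "(\<Sum>p\<in>A. (norm (W p))\<^sup>2) \<le> (\<Sum>k=1..n. (norm (W k))\<^sup>2)"
    using A by (intro sum_mono2) auto
  also have "\<dots> \<le> (\<Sum>y\<in>Y. \<Sum>y'\<in>Y. norm (b y) * norm (b y') * fejer n (\<eta> y * cnj (\<eta> y')))"
    unfolding W_def
  proof (rule sum_norm_sq_le_fejer[OF finY n])
    fix y assume "y \<in> Y"
    then have "fst y \<in> X" "snd y \<in> farey M z" by (auto simp: Y_def)
    then show "norm (\<eta> y) = 1" using normX fareyD(5) by (simp add: \<eta>_def case_prod_unfold norm_mult)
  qed
  also have "\<dots> = (\<Sum>x\<in>X. \<Sum>x'\<in>X. norm (U x) * norm (U x') * farey_form n M z (x * cnj x'))"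
  proof -
    have nb: "norm (b (x, i)) = norm (U x) * (1 / real (fst i))" if "i \<in> farey M z" for x i
    proof -
      have "norm (primitive_root_sum (fst i)) = 1"
        using primitive_root_sum_squarefree[of "fst i"] fareyD(1)[OF that] by (auto simp: rough_def squarefrees_def)
      then show ?thesis by (simp add: b_def norm_mult norm_divide)
    qed
    have "(\<Sum>y\<in>Y. \<Sum>y'\<in>Y. norm (b y) * norm (b y') * fejer n (\<eta> y * cnj (\<eta> y')))
        = (\<Sum>x\<in>X. \<Sum>i\<in>farey M z. \<Sum>x'\<in>X. \<Sum>j\<in>farey M z.
            norm (b (x, i)) * norm (b (x', j)) * fejer n (\<eta> (x, i) * cnj (\<eta> (x', j))))"
      unfolding Y_def sum.cartesian_product' ..
    also have "\<dots> = (\<Sum>x\<in>X. \<Sum>x'\<in>X. \<Sum>i\<in>farey M z. \<Sum>j\<in>farey M z.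
            norm (b (x, i)) * norm (b (x', j)) * fejer n (\<eta> (x, i) * cnj (\<eta> (x', j))))"
      by (rule sum.cong[OF refl], rule sum.swap)
    also have "\<dots> = (\<Sum>x\<in>X. \<Sum>x'\<in>X. norm (U x) * norm (U x') * farey_form n M z (x * cnj x'))"
      unfolding farey_form_def sum_distrib_left
    proof (intro sum.cong refl)
      fix x x' i j assume "i \<in> farey M z" "j \<in> farey M z"
      then show "norm (b (x, i)) * norm (b (x', j)) * fejer n (\<eta> (x, i) * cnj (\<eta> (x', j)))
         = norm (U x) * norm (U x') * (1 / real (fst i) * (1 / real (fst j)) * fejer n (x * cnj x' * (snd i * cnj (snd j))))"
        by (simp add: nb \<eta>_def mult_ac)
    qed
    finally show ?thesis .
  qed
  also have "\<dots> \<le> (\<Sum>x\<in>X. \<Sum>x'\<in>X. ((norm (U x))\<^sup>2 + (norm (U x'))\<^sup>2) / 2 * ((if x = x' then 4 * real n * G else 0) + (4 * real n * (G / m) + F)))"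
  proof (intro sum_mono mult_mono)
    fix x x' assume x: "x \<in> X" and x': "x' \<in> X"
    show "norm (U x) * norm (U x') \<le> ((norm (U x))\<^sup>2 + (norm (U x'))\<^sup>2) / 2"
      using sum_squares_bound[of "norm (U x)" "norm (U x')"] by simp
    show "0 \<le> farey_form n M z (x * cnj x')"
      unfolding farey_form_def by (intro sum_nonneg mult_nonneg_nonneg fejer_nonneg) auto
    have Gm: "0 \<le> 4 * real n * (G / m)" using G0 m1 by simp
    show "farey_form n M z (x * cnj x') \<le> (if x = x' then 4 * real n * G else 0) + (4 * real n * (G / m) + F)"
    proof (cases "x = x'")
      case True
      then have "x * cnj x' = 1" using normX[OF x] by (simp flip: complex_norm_square)
      then show ?thesis using farey_form_1_le[OF z n, of M] True Gm by (simp add: G_def F_def)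
    next
      case False
      have "x * cnj x' \<noteq> 1"
      proof
        assume "x * cnj x' = 1"
        moreover have "x' * cnj x' = 1" using normX[OF x'] by (simp flip: complex_norm_square)
        ultimately have "(x - x') * cnj x' = 0" by (simp add: algebra_simps)
        then show False using False normX[OF x'] by auto
      qed
      moreover have "(x * cnj x') ^ n = 1"
        using X x x' by (simp add: power_mult_distrib subset_iff flip: complex_cnj_power)
      ultimately show ?thesis
        using farey_form_root_of_unity_le[OF z n, of "x * cnj x'" m M] M m1 False
        by (simp add: G_def F_def m_def)
    qed
  qed auto
  also have "\<dots> = (\<Sum>x\<in>X. \<Sum>x'\<in>X. ((norm (U x))\<^sup>2 + (norm (U x'))\<^sup>2) / 2 * (if x = x' then 4 * real n * G else 0))
       + (\<Sum>x\<in>X. \<Sum>x'\<in>X. ((norm (U x))\<^sup>2 + (norm (U x'))\<^sup>2) / 2 * (4 * real n * (G / m) + F))"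
    by (simp only: distrib_left sum.distrib)
  \<comment> \<open>The mixed terms have been symmetrized, so both double sums are multiples of \<open>Z\<close>.\<close>
  also have "(\<Sum>x\<in>X. \<Sum>x'\<in>X. ((norm (U x))\<^sup>2 + (norm (U x'))\<^sup>2) / 2 * (if x = x' then 4 * real n * G else 0)) = 4 * real n * G * Z"
    using X(2) by (simp add: if_distrib sum.delta' Z_def sum_distrib_left mult_ac cong: if_cong)
  also have "(\<Sum>x\<in>X. \<Sum>x'\<in>X. ((norm (U x))\<^sup>2 + (norm (U x'))\<^sup>2) / 2 * (4 * real n * (G / m) + F)) = m * Z * (4 * real n * (G / m) + F)"
  proof -
    have "(\<Sum>x\<in>X. \<Sum>x'\<in>X. ((norm (U x))\<^sup>2 + (norm (U x'))\<^sup>2) / 2) = m * Z"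
      by (simp add: sum.distrib add_divide_distrib flip: sum_divide_distrib)
         (simp add: Z_def m_def sum_divide_distrib sum_distrib_left)
    then show ?thesis by (simp only: flip: sum_distrib_right)
  qed
  also have "4 * real n * G * Z + m * Z * (4 * real n * (G / m) + F) \<le> Z * B"
    using m1 Z0 F0 by (simp add: B_def algebra_simps)
  finally have "(G * Z)\<^sup>2 \<le> (\<Sum>p\<in>A. (norm (u p))\<^sup>2) * (Z * B)"
    by (simp add: mult_left_mono sum_nonneg)
  then have *: "Z * (G\<^sup>2 * Z) \<le> Z * ((\<Sum>p\<in>A. (norm (u p))\<^sup>2) * B)"
    by (simp add: power2_eq_square mult_ac)
  have "G\<^sup>2 * Z \<le> (\<Sum>p\<in>A. (norm (u p))\<^sup>2) * B"
  proof (cases "Z = 0")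
    case True
    have "B \<ge> 0" using G0 F0 m1 by (simp add: B_def)
    then show ?thesis using True by (simp add: sum_nonneg)
  next
    case False
    then show ?thesis using * Z0 by simp
  qed
  then show ?thesis unfolding Z_def B_def G_def m_def F_def U_def .
qed

text \<open>
The level \<open>z\<close> is about \<open>n^(1/6)\<close>: the error terms of the large sieve require \<open>z\<^sup>1\<^sup>2 \<le> n\<^sup>2\<close>, and
\<open>ln n \<le> 7 ln z\<close> keeps logarithms comparable.
\<close>

lemma ex_sixth_root:
  assumes "n \<ge> 10 ^ 6"
  obtains z :: nat where "z \<ge> 10" "z ^ 6 \<le> n" "n \<le> z ^ 7"
proof -
  define k where "k = (LEAST k. n < k ^ 6)"
  have "n < (n + 1) ^ 6"
  proof -
    have "n < n + 1" by simp
    also have "\<dots> \<le> (n + 1) ^ 6" by (rule self_le_power) auto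
    finally show ?thesis .
  qed
  then have k: "n < k ^ 6" unfolding k_def by (rule LeastI)
  have k10: "k > 10"
  proof (rule ccontr)
    assume "\<not> k > 10"
    then have "k ^ 6 \<le> 10 ^ 6" by (intro power_mono) auto
    then show False using k assms by simp
  qed
  define z where "z = k - 1"
  have z: "z \<ge> 10" "k = z + 1" using k10 by (auto simp: z_def)
  have "\<not> n < z ^ 6" using not_less_Least[of z "\<lambda>k. n < k ^ 6"] z(2) unfolding k_def by simp
  moreover have "n \<le> z ^ 7"
  proof -
    have "10 * (z + 1) \<le> 11 * z" using z(1) by simp
    then have "(10 * (z + 1)) ^ 6 \<le> (11 * z) ^ 6" by (rule power_mono) simp
    then have "1000000 * (z + 1) ^ 6 \<le> 1771561 * z ^ 6" by (simp only: power_mult_distrib) simp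
    also have "\<dots> \<le> 1000000 * (10 * z ^ 6)" by simp
    also have "\<dots> \<le> 1000000 * (z * z ^ 6)" using z(1) by (intro mult_left_mono mult_right_mono) auto
    finally have "(z + 1) ^ 6 \<le> z * z ^ 6" by linarith
    then show ?thesis using k z(2) by (simp add: power_Suc[symmetric] del: power_Suc)
  qed
  ultimately show ?thesis using that z(1) by simp
qed

lemma rough_sum_ge_1: "z \<ge> 1 \<Longrightarrow> rough_sum M z \<ge> 1"
proof -
  assume z: "z \<ge> 1"
  have "1 \<in> rough M z" using z by (auto simp: rough_def squarefrees_def)
  then have "(\<Sum>q\<in>{1::nat}. 1 / real q) \<le> rough_sum M z"
    unfolding rough_sum_def by (intro sum_mono2) auto
  then show ?thesis by simp
qed

lemma rough_1: "rough M 1 = {1}"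
proof -
  have "q = 1" if "squarefree q" "q \<le> 1" for q :: nat using squarefree_pos[OF that(1)] that(2) by simp
  then show ?thesis by (auto simp: rough_def squarefrees_def)
qed

text \<open>
With \<open>z = 1\<close> only the trivial shift is left, and the general inequality becomes the classical large sieve
on the grid.
\<close>

lemma large_sieve_roots_of_unity:
  fixes u :: "nat \<Rightarrow> complex"
  assumes n: "n \<ge> 6" and X: "X \<subseteq> {x. x ^ n = 1}" and A: "A \<subseteq> {1..n}"
  shows "(\<Sum>x\<in>X. (norm (\<Sum>p\<in>A. u p * x ^ p))\<^sup>2) \<le> 12 * real n * (\<Sum>p\<in>A. (norm (u p))\<^sup>2)"
proof (cases "X = {}")
  case True
  then show ?thesis by (simp add: sum_nonneg)
next
  case False
  have finX: "finite X" using finite_subset[OF X finite_roots_unity] n by simp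
  have "card X \<le> card {x::complex. x ^ n = 1}" using X n by (intro card_mono finite_roots_unity) auto
  also have "\<dots> \<le> n" using n by (intro card_roots_unity) auto
  finally have cX: "real (card X) \<le> real n" by simp
  have G: "rough_sum (4 * (card X)\<^sup>2) 1 = 1" by (simp add: rough_sum_def rough_1[simplified])
  have "(rough_sum (4 * (card X)\<^sup>2) 1)\<^sup>2 * (\<Sum>x\<in>X. (norm (\<Sum>p\<in>A. u p * x ^ p))\<^sup>2)
    \<le> (\<Sum>p\<in>A. (norm (u p))\<^sup>2) * (8 * real n * rough_sum (4 * (card X)\<^sup>2) 1 + (real (card X) + 1) * (16 * real 1 ^ 10 / real n))"
    using n X finX False A by (intro large_sieve_rough) (auto simp: rough_1[simplified])
  also have "\<dots> \<le> (\<Sum>p\<in>A. (norm (u p))\<^sup>2) * (12 * real n)"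
  proof (intro mult_left_mono sum_nonneg)
    have "(real (card X) + 1) * (16 / real n) \<le> (real n + 1) * (16 / real n)"
      using cX by (intro mult_right_mono) auto
    also have "\<dots> \<le> 4 * real n"
    proof -
      have "16 + 16 * real n \<le> 4 * (real n * real n)"
      proof -
        have "6 * real n \<le> real n * real n" using n by (intro mult_right_mono) auto
        then show ?thesis using n by linarith
      qed
      then show ?thesis using n by (simp add: field_simps)
    qed
    finally show "8 * real n * rough_sum (4 * (card X)\<^sup>2) 1 + (real (card X) + 1) * (16 * real 1 ^ 10 / real n) \<le> 12 * real n"
      using G by simp
  qed auto
  finally show ?thesis unfolding G by (simp add: mult.commute)
qed

text \<open>
Sieving with moduli whose prime factors exceed \<open>M = 4m\<^sup>2\<close> is exactly what the large sieve needs for \<open>m\<close>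
points. Because \<open>ln M = 2 ln (2m)\<close>, the price for roughness is a factor \<open>ln (2m)\<close> only.
\<close>

lemma restriction_beyond_sifting_limit:
  fixes u :: "nat \<Rightarrow> complex"
  assumes z: "z \<ge> 10" "z ^ 6 \<le> n" and X: "X \<subseteq> {x. x ^ n = 1}" "X \<noteq> {}" "card X \<le> z"
    and A: "A \<subseteq> {p. prime p \<and> z < p \<and> p \<le> n}"
  shows "ln (real z) * (\<Sum>x\<in>X. (norm (\<Sum>p\<in>A. u p * x ^ p))\<^sup>2)
    \<le> 456 * real n * ln (2 * real (card X)) * (\<Sum>p\<in>A. (norm (u p))\<^sup>2)"
proof -
  define m where "m = card X"
  define M where "M = 4 * m\<^sup>2"
  define G where "G = rough_sum M z"
  define Z where "Z = (\<Sum>x\<in>X. (norm (\<Sum>p\<in>A. u p * x ^ p))\<^sup>2)"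
  define U where "U = (\<Sum>p\<in>A. (norm (u p))\<^sup>2)"
  define L where "L = ln (2 * real m)"
  have n0: "n > 0" using z by (metis bot_nat_0.extremum_uniqueI gr0I not_numeral_le_zero power_eq_0_iff)
  have finX: "finite X" using finite_subset[OF X(1) finite_roots_unity] n0 by simp
  have m1: "m \<ge> 1" using X finX by (simp add: m_def Suc_le_eq card_gt_0_iff)
  have G1: "G \<ge> 1" unfolding G_def using z by (intro rough_sum_ge_1) auto
  have Z0: "Z \<ge> 0" and U0: "U \<ge> 0" by (simp_all add: Z_def U_def sum_nonneg)
  have L23: "L \<ge> 2 / 3"
  proof -
    have "ln 2 \<le> L" using m1 unfolding L_def by (subst ln_le_cancel_iff) auto
    then show ?thesis using ln2_ge_two_thirds by linarith
  qed
  have "G\<^sup>2 * Z \<le> U * (8 * real n * G + (real m + 1) * (16 * real z ^ 10 / real n))"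
    unfolding G_def Z_def U_def m_def
  proof (rule large_sieve_rough[OF n0 _ X(1) finX X(2)])
    show "4 * (real (card X))\<^sup>2 \<le> real M" by (simp add: M_def m_def)
    show "A \<subseteq> {1..n}" using A prime_gt_0_nat by force
    show "coprime p q" if "p \<in> A" "q \<in> rough M z" for p q
    proof (rule prime_imp_coprime)
      show "prime p" using A that by auto
      show "\<not> p dvd q" using that A rough_le[OF that(2)] rough_pos[OF that(2)] by (auto dest!: dvd_imp_le)
    qed
  qed (use z in auto)
  also have "\<dots> \<le> U * (12 * real n * G)"
  proof (intro mult_left_mono)
    have "(real m + 1) * (16 * real z ^ 10 / real n) \<le> (2 * real z) * (16 * real z ^ 10 / real n)"
      using X(3) z by (intro mult_right_mono) (auto simp: m_def)
    also have "\<dots> = 32 * real z ^ 11 / real n" by (simp add: eval_nat_numeral)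
    also have "\<dots> \<le> 4 * real n"
    proof -
      have "32 * real z ^ 11 \<le> 4 * real z * real z ^ 11" using z by (intro mult_right_mono) auto
      also have "\<dots> = 4 * (real (z ^ 6) * real (z ^ 6))" by (simp add: eval_nat_numeral)
      also have "\<dots> \<le> 4 * (real n * real n)" using z(2) by (intro mult_left_mono mult_mono) (simp_all del: of_nat_power)
      finally show ?thesis using n0 by (simp add: divide_le_eq)
    qed
    also have "\<dots> \<le> 4 * real n * G" using mult_left_mono[OF G1, of "4 * real n"] by simp
    finally show "8 * real n * G + (real m + 1) * (16 * real z ^ 10 / real n) \<le> 12 * real n * G" by linarith
  qed (rule U0)
  finally have "G * (G * Z) \<le> G * (12 * real n * U)" by (simp add: power2_eq_square mult_ac)
  then have GZ: "G * Z \<le> 12 * real n * U" using G1 by simp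
  have M2: "M \<ge> 2"
  proof -
    have "1\<^sup>2 \<le> m\<^sup>2" using m1 by (intro power_mono) auto
    then show ?thesis by (simp add: M_def)
  qed
  have "ln (real z) \<le> ln (real z + 1)" using z by (subst ln_le_cancel_iff) auto
  also have "\<dots> \<le> (4 + 16 * ln (real M)) * G" unfolding G_def rough_sum_def by (rule ln_le_sum_rough[OF M2])
  also have "ln (real M) = 2 * L"
  proof -
    have "real M = (2 * real m) ^ 2" by (simp add: M_def power_mult_distrib)
    then have "ln (real M) = ln ((2 * real m) ^ 2)" by (rule arg_cong)
    also have "\<dots> = real 2 * L" unfolding L_def by (rule ln_realpow)
    finally show ?thesis by simp
  qed
  also have "(4 + 16 * (2 * L)) * G \<le> (38 * L) * G" using L23 G1 by (intro mult_right_mono) auto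
  finally have lnz: "ln (real z) \<le> 38 * L * G" .
  have "ln (real z) * Z \<le> 38 * L * G * Z" using lnz Z0 by (rule mult_right_mono)
  also have "\<dots> = 38 * L * (G * Z)" by simp
  also have "\<dots> \<le> 38 * L * (12 * real n * U)" using GZ L23 by (intro mult_left_mono) auto
  finally show ?thesis unfolding Z_def U_def L_def m_def by (simp add: mult_ac)
qed

text \<open>
For more than \<open>z\<close> points \<open>ln (2m)\<close> is comparable with \<open>ln n\<close>, and the classical large sieve suffices.
Otherwise the primes up to \<open>z\<close>, which may divide the moduli, are few enough for the Cauchy-Schwarz
inequality, and the sieve handles the others.
\<close>

lemma restriction_estimate:
  fixes u :: "nat \<Rightarrow> complex"
  assumes z: "z \<ge> 10" "z ^ 6 \<le> n" "n \<le> z ^ 7" and X: "X \<subseteq> {x. x ^ n = 1}" "X \<noteq> {}"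
  shows "ln (real n) * (\<Sum>x\<in>X. (norm (\<Sum>p | prime p \<and> p \<le> n. u p * x ^ p))\<^sup>2)
    \<le> 6400 * real n * ln (2 * real (card X)) * (\<Sum>p | prime p \<and> p \<le> n. (norm (u p))\<^sup>2)"
proof -
  define m where "m = card X"
  define A where "A = {p. prime p \<and> p \<le> n}"
  define U where "U = (\<Sum>p\<in>A. (norm (u p))\<^sup>2)"
  define L where "L = ln (2 * real m)"
  define Z where "Z = (\<Sum>x\<in>X. (norm (\<Sum>p\<in>A. u p * x ^ p))\<^sup>2)"
  have "10 \<le> z ^ 6" using z(1) self_le_power[of z 6] by simp
  then have n10: "n \<ge> 10" using z(2) by simp
  have finX: "finite X" using finite_subset[OF X(1) finite_roots_unity] n10 by simp
  have m1: "m \<ge> 1" using X finX by (simp add: m_def Suc_le_eq card_gt_0_iff)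
  have finA: "finite A" by (simp add: A_def)
  have U0: "U \<ge> 0" and Z0: "Z \<ge> 0" by (simp_all add: U_def Z_def sum_nonneg)
  have L23: "L \<ge> 2 / 3"
  proof -
    have "ln 2 \<le> L" using m1 unfolding L_def by (subst ln_le_cancel_iff) auto
    then show ?thesis using ln2_ge_two_thirds by linarith
  qed
  have lnz: "ln (real n) \<le> 7 * ln (real z)"
  proof -
    have "real n \<le> real (z ^ 7)" using z(3) by (simp only: of_nat_le_iff)
    then have "ln (real n) \<le> ln (real z ^ 7)" using n10 z(1) by (subst ln_le_cancel_iff) auto
    then show ?thesis using z(1) by (simp add: ln_realpow)
  qed
  have lnz0: "ln (real z) \<ge> 0" "ln (real n) \<ge> 0" using z(1) n10 by auto
  have "ln (real n) * Z \<le> 6400 * real n * L * U"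
  proof (cases "m \<le> z")
    case False
    have "Z \<le> 12 * real n * U" unfolding Z_def U_def
      using n10 X prime_gt_0_nat by (intro large_sieve_roots_of_unity) (auto simp: A_def Suc_le_eq)
    moreover have "ln (real n) \<le> 7 * L"
    proof -
      have "ln (real z) \<le> L" using False z(1) unfolding L_def by (subst ln_le_cancel_iff) auto
      then show ?thesis using lnz by simp
    qed
    ultimately have "ln (real n) * Z \<le> (7 * L) * (12 * real n * U)"
      using L23 Z0 by (intro mult_mono) auto
    also have "\<dots> = 84 * (real n * L * U)" by simp
    also have "\<dots> \<le> 6400 * (real n * L * U)" using L23 U0 by (intro mult_right_mono) auto
    finally show ?thesis by (simp add: mult_ac)
  next
    case True
    define A1 where "A1 = {p\<in>A. p \<le> z}"
    define A2 where "A2 = {p\<in>A. z < p}"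
    define U1 where "U1 = (\<lambda>x. \<Sum>p\<in>A1. u p * x ^ p)"
    define U2 where "U2 = (\<lambda>x. \<Sum>p\<in>A2. u p * x ^ p)"
    have A12: "A = A1 \<union> A2" "A1 \<inter> A2 = {}" "finite A1" "finite A2"
      using finA by (auto simp: A1_def A2_def)
    have norm_A1: "(\<Sum>p\<in>A1. (norm (u p))\<^sup>2) \<le> U" and norm_A2: "(\<Sum>p\<in>A2. (norm (u p))\<^sup>2) \<le> U"
      unfolding U_def using finA A12 by (intro sum_mono2; auto)+
    have "Z \<le> (\<Sum>x\<in>X. 2 * (norm (U1 x))\<^sup>2 + 2 * (norm (U2 x))\<^sup>2)"
      unfolding Z_def
    proof (intro sum_mono)
      fix x
      have "(\<Sum>p\<in>A. u p * x ^ p) = U1 x + U2 x"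
        unfolding A12(1) U1_def U2_def using A12 by (intro sum.union_disjoint)
      then have "(norm (\<Sum>p\<in>A. u p * x ^ p))\<^sup>2 \<le> (norm (U1 x) + norm (U2 x))\<^sup>2"
        by (simp add: norm_triangle_ineq power_mono)
      also have "\<dots> \<le> 2 * (norm (U1 x))\<^sup>2 + 2 * (norm (U2 x))\<^sup>2"
        using sum_squares_bound[of "norm (U1 x)" "norm (U2 x)"] by (simp add: power2_sum)
      finally show "(norm (\<Sum>p\<in>A. u p * x ^ p))\<^sup>2 \<le> 2 * (norm (U1 x))\<^sup>2 + 2 * (norm (U2 x))\<^sup>2" .
    qed
    then have Z12: "Z \<le> 2 * (\<Sum>x\<in>X. (norm (U1 x))\<^sup>2) + 2 * (\<Sum>x\<in>X. (norm (U2 x))\<^sup>2)"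
      by (simp add: sum.distrib sum_distrib_left)
    have Z2: "ln (real z) * (\<Sum>x\<in>X. (norm (U2 x))\<^sup>2) \<le> 456 * (real n * L) * U"
    proof -
      have "ln (real z) * (\<Sum>x\<in>X. (norm (U2 x))\<^sup>2) \<le> 456 * real n * L * (\<Sum>p\<in>A2. (norm (u p))\<^sup>2)"
        unfolding U2_def L_def m_def using z X True
        by (intro restriction_beyond_sifting_limit) (auto simp: A2_def A_def m_def)
      also have "\<dots> \<le> 456 * real n * L * U" using norm_A2 L23 by (intro mult_left_mono) auto
      finally show ?thesis by simp
    qed
    have "(\<Sum>x\<in>X. (norm (U1 x))\<^sup>2) \<le> (\<Sum>x\<in>X. real z * U)"
    proof (intro sum_mono)
      fix x assume "x \<in> X"
      then have nx: "norm x = 1" using X root_of_unity_norm[of x n] n10 by auto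
      have "norm (U1 x) \<le> (\<Sum>p\<in>A1. 1 * norm (u p))"
        unfolding U1_def using nx by (intro sum_norm_le) (simp add: norm_mult norm_power)
      then have "(norm (U1 x))\<^sup>2 \<le> (\<Sum>p\<in>A1. 1 * norm (u p))\<^sup>2" by (intro power_mono) auto
      also have "\<dots> \<le> (\<Sum>p\<in>A1. 1\<^sup>2) * (\<Sum>p\<in>A1. (norm (u p))\<^sup>2)" by (rule Cauchy_Schwarz_ineq_sum)
      also have "\<dots> \<le> real z * U"
      proof (intro mult_mono norm_A1)
        have "A1 \<subseteq> {1..z}" using prime_gt_0_nat by (auto simp: A1_def A_def Suc_le_eq)
        then have "card A1 \<le> z" using card_mono[of "{1..z}" A1] by simp
        then show "(\<Sum>p\<in>A1. 1\<^sup>2) \<le> real z" by simp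
      qed (auto simp: sum_nonneg)
      finally show "(norm (U1 x))\<^sup>2 \<le> real z * U" .
    qed
    also have "\<dots> = real m * (real z * U)" by (simp add: m_def)
    also have "\<dots> \<le> real z * (real z * U)" using True U0 by (intro mult_right_mono) auto
    finally have Z1: "(\<Sum>x\<in>X. (norm (U1 x))\<^sup>2) \<le> real z * (real z * U)" .
    have "7 * ln (real z) * (\<Sum>x\<in>X. (norm (U1 x))\<^sup>2) \<le> (7 * real z) * (real z * (real z * U))"
      using lnz0 z(1) ln_bound[of "real z"] Z1 by (intro mult_mono) (auto simp: sum_nonneg)
    also have "\<dots> = 7 * real z ^ 3 * U" by (simp add: eval_nat_numeral)
    also have "\<dots> \<le> real n * L * U"
    proof (intro mult_right_mono U0)
      have "1000 \<le> real z ^ 3" using power_mono[of 10 "real z" 3] z(1) by simp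
      then have "7 * real z ^ 3 * 1000 \<le> 7 * real z ^ 3 * real z ^ 3" by (intro mult_left_mono) auto
      also have "\<dots> = 7 * real (z ^ 6)" by (simp add: eval_nat_numeral)
      also have "\<dots> \<le> 7 * real n" using z(2) by (intro mult_left_mono) (simp_all del: of_nat_power)
      finally have "7 * real z ^ 3 \<le> real n * (2 / 3)" by linarith
      also have "\<dots> \<le> real n * L" using L23 by (intro mult_left_mono) auto
      finally show "7 * real z ^ 3 \<le> real n * L" .
    qed
    finally have Z1': "7 * ln (real z) * (\<Sum>x\<in>X. (norm (U1 x))\<^sup>2) \<le> real n * L * U" .
    have "ln (real n) * Z \<le> 7 * ln (real z) * (2 * (\<Sum>x\<in>X. (norm (U1 x))\<^sup>2) + 2 * (\<Sum>x\<in>X. (norm (U2 x))\<^sup>2))"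
      using lnz Z12 lnz0 Z0 by (intro mult_mono) auto
    also have "\<dots> = 2 * (7 * ln (real z) * (\<Sum>x\<in>X. (norm (U1 x))\<^sup>2)) + 14 * (ln (real z) * (\<Sum>x\<in>X. (norm (U2 x))\<^sup>2))"
      by (simp add: algebra_simps)
    also have "\<dots> \<le> 2 * (real n * L * U) + 14 * (456 * (real n * L) * U)"
      using Z1' Z2 by (intro add_mono mult_left_mono) auto
    also have "\<dots> = 6386 * (real n * L * U)" by simp
    also have "\<dots> \<le> 6400 * (real n * L * U)" using L23 U0 by (intro mult_right_mono) auto
    finally show ?thesis by (simp add: mult_ac)
  qed
  then show ?thesis unfolding Z_def U_def L_def m_def A_def .
qed

section \<open>From partial sums to power sums\<close>

lemma powr_above_tangent:
  fixes x y s :: real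
  assumes "x \<ge> 0" "y \<ge> 0" "s \<ge> 1"
  shows "y powr s + s * y powr (s - 1) * (x - y) \<le> x powr s"
proof (cases "y = 0")
  case False
  then have y: "y > 0" using assms by simp
  show ?thesis
  proof (cases "x = 0")
    case True
    have "y powr s = y powr (s - 1) * y" using y by (simp add: powr_diff)
    then have "y powr s + s * y powr (s - 1) * (x - y) = (1 - s) * (y powr (s - 1) * y)"
      using True by (simp add: algebra_simps)
    also have "\<dots> \<le> 0" using y assms by (intro mult_nonpos_nonneg) auto
    finally show ?thesis using True by simp
  next
    case False
    then have "x > 0" using assms by simp
    have "s * y powr (s - 1) * (x - y) \<le> x powr s - y powr s"
      using y \<open>x > 0\<close> assms(3)
      by (intro convex_on_imp_above_tangent[OF powr_convex[OF assms(3)]])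
         (auto simp: interior_open intro!: derivative_eq_intros)
    then show ?thesis by simp
  qed
qed auto

lemma abel_summation_ge:
  fixes w d :: "nat \<Rightarrow> real"
  assumes "\<And>i. i < n \<Longrightarrow> w (Suc i) \<le> w i" "\<And>m. m \<le> Suc n \<Longrightarrow> 0 \<le> (\<Sum>i<m. d i)"
  shows "w n * (\<Sum>i<Suc n. d i) \<le> (\<Sum>i<Suc n. w i * d i)"
  using assms
proof (induction n)
  case (Suc n)
  have "w (Suc n) * (\<Sum>i<Suc (Suc n). d i) = w (Suc n) * (\<Sum>i<Suc n. d i) + w (Suc n) * d (Suc n)"
    by (simp add: algebra_simps)
  also have "w (Suc n) * (\<Sum>i<Suc n. d i) \<le> w n * (\<Sum>i<Suc n. d i)"
    using Suc.prems(1)[of n] Suc.prems(2)[of "Suc n"] by (intro mult_right_mono) auto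
  also have "\<dots> \<le> (\<Sum>i<Suc n. w i * d i)"
    using Suc.prems by (intro Suc.IH) auto
  finally show ?case by simp
qed simp

text \<open>
Weak majorization (Karamata's inequality for powers). By convexity
\<open>b^s \<ge> a^s + s a^(s-1) (b - a)\<close>; the slopes decrease with \<open>i\<close> because \<open>a\<close> does, and so summation by parts
with nonnegative partial sums of \<open>b - a\<close> shows that the linear terms add up to something nonnegative.
\<close>

lemma sum_powr_mono_of_prefix_sums:
  fixes a b :: "nat \<Rightarrow> real"
  assumes a: "\<And>i. i < n \<Longrightarrow> a i \<ge> 0" and b: "\<And>i. i < n \<Longrightarrow> b i \<ge> 0"
    and dec: "\<And>i j. i \<le> j \<Longrightarrow> j < n \<Longrightarrow> a j \<le> a i"
    and prefix: "\<And>m. m \<le> n \<Longrightarrow> (\<Sum>i<m. a i) \<le> (\<Sum>i<m. b i)"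
    and s: "s \<ge> 1"
  shows "(\<Sum>i<n. a i powr s) \<le> (\<Sum>i<n. b i powr s)"
proof (cases n)
  case (Suc k)
  define w where "w = (\<lambda>i. s * a i powr (s - 1))"
  define d where "d = (\<lambda>i. b i - a i)"
  have "w k * (\<Sum>i<Suc k. d i) \<le> (\<Sum>i<Suc k. w i * d i)"
  proof (rule abel_summation_ge)
    fix i assume "i < k"
    then show "w (Suc i) \<le> w i" unfolding w_def using a dec[of i "Suc i"] s Suc
      by (intro mult_left_mono powr_mono2) auto
  next
    fix m assume "m \<le> Suc k"
    then show "0 \<le> (\<Sum>i<m. d i)" using prefix[of m] Suc by (simp add: d_def sum_subtractf)
  qed
  moreover have "0 \<le> w k * (\<Sum>i<Suc k. d i)"
    using prefix[of n] Suc s by (intro mult_nonneg_nonneg) (auto simp: w_def d_def sum_subtractf)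
  ultimately have "0 \<le> (\<Sum>i<n. w i * d i)" using Suc by simp
  also have "\<dots> \<le> (\<Sum>i<n. b i powr s - a i powr s)"
    using powr_above_tangent[OF b a s] by (intro sum_mono) (simp add: w_def d_def algebra_simps)
  finally show ?thesis by (simp add: sum_subtractf)
qed simp

lemma ex_decreasing_enumeration:
  fixes f :: "'a \<Rightarrow> real"
  assumes "finite X"
  shows "\<exists>\<sigma>. bij_betw \<sigma> {..<card X} X \<and> (\<forall>i j. i \<le> j \<longrightarrow> j < card X \<longrightarrow> f (\<sigma> j) \<le> f (\<sigma> i))"
proof -
  obtain xs where xs: "set xs = X" "distinct xs" using finite_distinct_list[OF assms] by blast
  define ys where "ys = sort_key (\<lambda>x. - f x) xs"
  have ys: "set ys = X" "distinct ys" using xs by (simp_all add: ys_def)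
  then have len: "length ys = card X" using distinct_card by fastforce
  have sorted: "sorted (map (\<lambda>x. - f x) ys)" by (simp add: ys_def)
  have "bij_betw (\<lambda>i. ys ! i) {..<card X} X" using bij_betw_nth[OF ys(2)] ys(1) len by auto
  moreover have "f (ys ! j) \<le> f (ys ! i)" if "i \<le> j" "j < card X" for i j
    using sorted_nth_mono[OF sorted that(1)] that len by simp
  ultimately show ?thesis by blast
qed

text \<open>
Logarithmic bounds on the sums over all subsets say that the decreasing rearrangement of \<open>a\<close> has
partial sums below those of \<open>2 D / i\<close>, since \<open>ln (2m) \<le> 2 ln (m + 1)\<close> is at most twice a harmonic number.
Majorization then bounds the power sums as if \<open>a\<close> itself were \<open>2 D / i\<close>; bounding level sets one at
a time would lose a logarithm here.
\<close>

lemma sum_powr_le_of_log_sums: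
  fixes a :: "'a \<Rightarrow> real"
  assumes "finite X" and a: "\<And>x. x \<in> X \<Longrightarrow> a x \<ge> 0" and "D \<ge> 0" "s \<ge> 1"
    and log: "\<And>J. J \<subseteq> X \<Longrightarrow> J \<noteq> {} \<Longrightarrow> (\<Sum>x\<in>J. a x) \<le> D * ln (2 * real (card J))"
  shows "(\<Sum>x\<in>X. a x powr s) \<le> (2 * D) powr s * (\<Sum>i=1..card X. 1 / real i powr s)"
proof -
  obtain \<sigma> where \<sigma>: "bij_betw \<sigma> {..<card X} X" "\<forall>i j. i \<le> j \<longrightarrow> j < card X \<longrightarrow> a (\<sigma> j) \<le> a (\<sigma> i)"
    using ex_decreasing_enumeration[OF assms(1)] by blast
  have in_X: "\<sigma> i \<in> X" if "i < card X" for i using \<sigma>(1) that by (auto simp: bij_betw_def)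
  have "(\<Sum>x\<in>X. a x powr s) = (\<Sum>i<card X. a (\<sigma> i) powr s)"
    using sum.reindex_bij_betw[OF \<sigma>(1), of "\<lambda>x. a x powr s"] by simp
  also have "\<dots> \<le> (\<Sum>i<card X. (2 * D / real (Suc i)) powr s)"
  proof (rule sum_powr_mono_of_prefix_sums)
    fix m assume m: "m \<le> card X"
    show "(\<Sum>i<m. a (\<sigma> i)) \<le> (\<Sum>i<m. 2 * D / real (Suc i))"
    proof (cases "m = 0")
      case False
      have inj: "inj_on \<sigma> {..<m}" using \<sigma>(1) m by (auto simp: bij_betw_def intro: inj_on_subset)
      have "(\<Sum>i<m. a (\<sigma> i)) = (\<Sum>x\<in>\<sigma> ` {..<m}. a x)" using inj by (simp add: sum.reindex)
      also have "\<dots> \<le> D * ln (2 * real (card (\<sigma> ` {..<m})))"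
        using m in_X False by (intro log) auto
      also have "card (\<sigma> ` {..<m}) = m" using inj by (simp add: card_image)
      also have "D * ln (2 * real m) \<le> D * (2 * ln (real m + 1))"
      proof (intro mult_left_mono)
        have "2 * real m \<le> (real m + 1)\<^sup>2" by (simp add: power2_eq_square algebra_simps)
        then have "ln (2 * real m) \<le> ln ((real m + 1)\<^sup>2)"
          using False by (subst ln_le_cancel_iff) auto
        then show "ln (2 * real m) \<le> 2 * ln (real m + 1)" by (simp add: ln_realpow)
      qed (use assms in auto)
      also have "\<dots> \<le> D * (2 * harm m)"
        using assms ln_le_harm by (intro mult_left_mono) auto
      also have "\<dots> = (\<Sum>i<m. 2 * D / real (Suc i))"
        by (simp add: harm_altdef sum_distrib_left divide_inverse mult_ac)
      finally show ?thesis .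
    qed simp
  qed (use assms in_X \<sigma>(2) in auto)
  also have "\<dots> = (2 * D) powr s * (\<Sum>i<card X. 1 / real (Suc i) powr s)"
    using assms by (simp add: powr_divide sum_distrib_left)
  also have "(\<Sum>i<card X. 1 / real (Suc i) powr s) = (\<Sum>i=1..card X. 1 / real i powr s)"
    by (rule sum.reindex_bij_witness[of _ "\<lambda>i. i - 1" Suc]) auto
  finally show ?thesis .
qed

text \<open>
By induction with the tail \<open>1 / (r n^r)\<close> of the corresponding integral as correction term.
\<close>

lemma sum_powr_tail_le:
  assumes "r > 0"
  shows "(\<Sum>i=1..n. 1 / real i powr (1 + r)) \<le> 1 + 1 / r"
proof -
  have "(\<Sum>i=1..Suc n. 1 / real i powr (1 + r)) \<le> 1 + 1 / r - 1 / (r * real (Suc n) powr r)" for n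
  proof (induction n)
    case (Suc n)
    let ?x = "real (Suc n)" and ?y = "real (Suc (Suc n))"
    have "1 + r / ?y \<le> (?y / ?x) powr r"
    proof -
      have "ln (?x / ?y) \<le> ?x / ?y - 1" by (rule ln_le_minus_one) simp
      also have "\<dots> = - (1 / ?y)" by (simp add: field_simps)
      finally have "1 / ?y \<le> ln (?y / ?x)" by (simp add: ln_div)
      then have "r * (1 / ?y) \<le> r * ln (?y / ?x)" using assms by (intro mult_left_mono) auto
      then have "1 + r / ?y \<le> 1 + r * ln (?y / ?x)" by simp
      also have "\<dots> \<le> exp (r * ln (?y / ?x))" by (rule exp_ge_add_one_self)
      finally show ?thesis by (simp add: powr_def)
    qed
    then have ratio: "1 + r / ?y \<le> ?y powr r / ?x powr r"
      by (simp only: powr_divide of_nat_0_le_iff)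
    have "1 / (r * ?y powr r) + 1 / (?y powr (1 + r)) = 1 / (r * ?y powr r) * (1 + r / ?y)"
      using assms by (simp add: powr_add distrib_left) (simp add: algebra_simps)
    also have "\<dots> \<le> 1 / (r * ?y powr r) * (?y powr r / ?x powr r)"
      using ratio assms by (intro mult_left_mono) auto
    also have "\<dots> = 1 / (r * ?x powr r)" by simp
    finally have "1 / (r * ?y powr r) + 1 / (?y powr (1 + r)) \<le> 1 / (r * ?x powr r)" .
    then show ?case using Suc by simp
  qed (use assms in simp)
  note * = this
  show ?thesis
  proof (cases n)
    case 0
    then show ?thesis using assms by simp
  next
    case (Suc m)
    have "0 \<le> 1 / (r * real (Suc m) powr r)" using assms by simp
    then show ?thesis unfolding Suc using *[of m] by linarith
  qed
qed

lemma sum_powr_le_ln: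
  assumes "s \<ge> 1" "n \<ge> 1"
  shows "(\<Sum>i=1..n. 1 / real i powr s) \<le> 1 + ln (real n)"
proof -
  have "(\<Sum>i=1..n. 1 / real i powr s) \<le> (\<Sum>i=1..n. 1 / real i powr 1)"
    using assms by (intro sum_mono divide_left_mono powr_mono) auto
  also have "\<dots> = harm n" by (simp add: harm_def inverse_eq_divide)
  also have "\<dots> \<le> 1 + ln (real n)"
    using decseqD[OF decseq_harm_diff_ln, of 0 "n - 1"] assms(2) by (simp add: harm_expand)
  finally show ?thesis .
qed

section \<open>Integrals over translated grids and over disjoint arcs\<close>

lemma integral_unit_interval_eq_sum_shifts:
  fixes f :: "real \<Rightarrow> real"
  assumes f: "continuous_on UNIV f" and n: "n > 0"
  shows "integral {0..1} f = integral {0..1 / real n} (\<lambda>t. \<Sum>j<n. f (t + real j / real n))"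
proof -
  have int: "f integrable_on {a..b}" for a b
    using f continuous_on_subset integrable_continuous_real by blast
  have shift: "integral {0..1 / real n} (\<lambda>t. f (t + real j / real n)) = integral {real j / real n..real (Suc j) / real n} f" for j
    using integral_shift_Icc_real[of 0 "1 / real n" f "real j / real n"]
    by (simp add: o_def add.commute add_divide_distrib)
  have "(\<Sum>j<m. integral {real j / real n..real (Suc j) / real n} f) = integral {0..real m / real n} f" for m
  proof (induction m)
    case (Suc m)
    have "integral {0..real m / real n} f + integral {real m / real n..real (Suc m) / real n} f = integral {0..real (Suc m) / real n} f"
      by (rule Henstock_Kurzweil_Integration.integral_combine) (auto simp: int divide_right_mono)
    then show ?case using Suc by simp
  qed simp
  from this[of n] have "integral {0..1} f = (\<Sum>j<n. integral {0..1 / real n} (\<lambda>t. f (t + real j / real n)))"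
    using n shift by simp
  also have "\<dots> = integral {0..1 / real n} (\<lambda>t. \<Sum>j<n. f (t + real j / real n))"
    by (rule integral_sum[symmetric])
       (auto intro!: integrable_continuous_real continuous_on_compose2[OF f] continuous_intros)
  finally show ?thesis .
qed

lemma sum_integral_arcs_le:
  fixes f :: "real \<Rightarrow> real"
  assumes f: "continuous_on UNIV f" "\<And>x. f x \<ge> 0" and I: "finite I" and h: "h \<ge> 0"
    and sub: "\<And>i. i \<in> I \<Longrightarrow> 0 \<le> \<theta> i \<and> \<theta> i + h \<le> 1"
    and sep: "\<And>i j. i \<in> I \<Longrightarrow> j \<in> I \<Longrightarrow> i \<noteq> j \<Longrightarrow> h < \<bar>\<theta> i - \<theta> j\<bar>"
  shows "integral {0..h} (\<lambda>t. \<Sum>i\<in>I. f (t + \<theta> i)) \<le> integral {0..1} f"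
proof -
  have int: "f integrable_on {a..b}" for a b
    using f continuous_on_subset integrable_continuous_real by blast
  have U: "(f has_integral (\<Sum>i\<in>I. integral {\<theta> i..\<theta> i + h} f)) (\<Union>i\<in>I. {\<theta> i..\<theta> i + h})"
  proof (rule has_integral_UN[OF I])
    show "pairwise (\<lambda>i j. negligible ({\<theta> i..\<theta> i + h} \<inter> {\<theta> j..\<theta> j + h})) I"
    proof (rule pairwiseI)
      fix i j assume ij: "i \<in> I" "j \<in> I" "i \<noteq> j"
      have "{\<theta> i..\<theta> i + h} \<inter> {\<theta> j..\<theta> j + h} = {}" using sep[OF ij] by auto
      then show "negligible ({\<theta> i..\<theta> i + h} \<inter> {\<theta> j..\<theta> j + h})" by simp
    qed
  qed (simp add: int integrable_integral)
  have "integral {0..h} (\<lambda>t. \<Sum>i\<in>I. f (t + \<theta> i)) = (\<Sum>i\<in>I. integral {0..h} (\<lambda>t. f (t + \<theta> i)))"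
    by (rule integral_sum[OF I])
       (auto intro!: integrable_continuous_real continuous_on_compose2[OF f(1)] continuous_intros)
  also have "\<dots> = (\<Sum>i\<in>I. integral {\<theta> i..\<theta> i + h} f)"
    using integral_shift_Icc_real[of 0 h f "\<theta> i" for i] by (simp add: o_def add.commute)
  also have "\<dots> = integral (\<Union>i\<in>I. {\<theta> i..\<theta> i + h}) f"
    using U by (simp add: integral_unique)
  also have "\<dots> \<le> integral {0..1} f"
  proof (rule integral_subset_le)
    show "f integrable_on (\<Union>i\<in>I. {\<theta> i..\<theta> i + h})" using U by blast
    show "(\<Union>i\<in>I. {\<theta> i..\<theta> i + h}) \<subseteq> {0..1}"
    proof
      fix x assume "x \<in> (\<Union>i\<in>I. {\<theta> i..\<theta> i + h})"
      then obtain i where "i \<in> I" "\<theta> i \<le> x" "x \<le> \<theta> i + h" by auto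
      then show "x \<in> {0..1}" using sub[of i] by simp
    qed
  qed (use f int in auto)
  finally show ?thesis .
qed

section \<open>The upper bound for moments of exponential sums over primes\<close>

lemma e_eq_cis: "e x = cis (2 * pi * x)"
  by (simp add: e_def cis_conv_exp mult_ac)

lemma e_add: "e (x + y) = e x * e y"
  by (simp add: e_eq_cis distrib_left cis_mult)

lemma e_mult_of_nat: "e (real p * x) = e x ^ p"
  by (simp add: e_eq_cis Complex.DeMoivre mult_ac)

lemma norm_e [simp]: "norm (e x) = 1"
  by (simp add: e_eq_cis)

lemma continuous_on_e [continuous_intros]:
  "continuous_on S f \<Longrightarrow> continuous_on S (\<lambda>x. e (f x))"
  unfolding e_def by (intro continuous_intros)

lemma exp_sum_shift:
  "(\<Sum>p\<in>A. u p * e (real p * (t + \<theta>))) = (\<Sum>p\<in>A. u p * e (real p * t) * e \<theta> ^ p)"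
  by (intro sum.cong refl) (simp add: distrib_left e_add e_mult_of_nat)

lemma continuous_exp_sum_powr:
  assumes "l > 0"
  shows "continuous_on UNIV (\<lambda>\<alpha>. norm (\<Sum>p\<in>A. u p * e (real p * \<alpha>)) powr l)"
  using assms by (intro continuous_on_powr' continuous_intros) auto

text \<open>
Split the unit interval into translates of the grid \<open>j/n\<close>. For a fixed translation \<open>t\<close>, the factors
\<open>e(pt)\<close> can be absorbed into the coefficients without changing their moduli, so the restriction estimate
applies to every subset of the grid and majorization bounds the power sum.
\<close>

lemma integral_exp_sum_le:
  fixes u :: "nat \<Rightarrow> complex"
  assumes z: "z \<ge> 10" "z ^ 6 \<le> n" "n \<le> z ^ 7" and l: "l \<ge> 2"
  shows "integral {0..1} (\<lambda>\<alpha>. norm (\<Sum>p | prime p \<and> p \<le> n. u p * e (real p * \<alpha>)) powr l)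
    \<le> 1 / real n * ((2 * (6400 * real n / ln (real n) * (\<Sum>p | prime p \<and> p \<le> n. (norm (u p))\<^sup>2))) powr (l / 2)
        * (\<Sum>i=1..n. 1 / real i powr (l / 2)))"
proof -
  define A where "A = {p. prime p \<and> p \<le> n}"
  define f where "f = (\<lambda>\<alpha>. norm (\<Sum>p\<in>A. u p * e (real p * \<alpha>)) powr l)"
  define D where "D = 6400 * real n / ln (real n) * (\<Sum>p\<in>A. (norm (u p))\<^sup>2)"
  define C where "C = (2 * D) powr (l / 2) * (\<Sum>i=1..n. 1 / real i powr (l / 2))"
  have "10 \<le> z ^ 6" using z(1) self_le_power[of z 6] by simp
  then have n10: "n \<ge> 10" using z(2) by simp
  have ln0: "ln (real n) > 0" using n10 by simp
  have D0: "D \<ge> 0" unfolding D_def using ln0 by (intro mult_nonneg_nonneg sum_nonneg) auto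
  have cont: "continuous_on UNIV f" unfolding f_def using l by (intro continuous_exp_sum_powr) auto
  have pointwise: "(\<Sum>j<n. f (t + real j / real n)) \<le> C" for t
  proof -
    define v where "v = (\<lambda>p. u p * e (real p * t))"
    define X where "X = {x::complex. x ^ n = 1}"
    define a where "a = (\<lambda>x. (norm (\<Sum>p\<in>A. v p * x ^ p))\<^sup>2)"
    have bij: "bij_betw (\<lambda>j. e (real j / real n)) {..<n} X"
      using Complex.bij_betw_roots_unity[of n] n10 by (simp add: X_def e_eq_cis)
    have "(\<Sum>j<n. f (t + real j / real n)) = (\<Sum>j<n. a (e (real j / real n)) powr (l / 2))"
    proof (intro sum.cong refl)
      fix j
      show "f (t + real j / real n) = a (e (real j / real n)) powr (l / 2)"
        unfolding f_def a_def v_def exp_sum_shift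
        by (simp add: powr_powr flip: powr_numeral)
    qed
    also have "\<dots> = (\<Sum>x\<in>X. a x powr (l / 2))" by (rule sum.reindex_bij_betw[OF bij])
    also have "\<dots> \<le> (2 * D) powr (l / 2) * (\<Sum>i=1..card X. 1 / real i powr (l / 2))"
    proof (rule sum_powr_le_of_log_sums)
      show "finite X" unfolding X_def using n10 by (intro finite_roots_unity) auto
      fix J assume J: "J \<subseteq> X" "J \<noteq> {}"
      have nv: "norm (v p) = norm (u p)" for p by (simp add: v_def norm_mult)
      have "ln (real n) * (\<Sum>x\<in>J. a x) \<le> 6400 * real n * ln (2 * real (card J)) * (\<Sum>p\<in>A. (norm (u p))\<^sup>2)"
        using restriction_estimate[OF z, of J v] J by (simp add: a_def A_def nv X_def)
      then show "(\<Sum>x\<in>J. a x) \<le> D * ln (2 * real (card J))"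
        using ln0 by (simp add: D_def field_simps)
    qed (use l D0 in \<open>auto simp: a_def\<close>)
    also have "card X = n" using bij_betw_same_card[OF bij] by simp
    finally show ?thesis unfolding C_def .
  qed
  have "integral {0..1} f = integral {0..1 / real n} (\<lambda>t. \<Sum>j<n. f (t + real j / real n))"
    using n10 by (intro integral_unit_interval_eq_sum_shifts cont) auto
  also have "\<dots> \<le> integral {0..1 / real n} (\<lambda>t. C)"
    by (intro integral_le pointwise)
       (auto intro!: integrable_continuous_real continuous_on_compose2[OF cont] continuous_intros)
  also have "\<dots> = 1 / real n * C" by simp
  finally show ?thesis unfolding f_def C_def D_def A_def .
qed

section \<open>The lower bound for the prime exponential sum\<close>

text \<open>
Allowing any \<open>q\<close> at least the cardinality makes it possible to use \<open>q\<close> in place of the exact number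
\<open>\<phi>(q)\<close> of primitive roots.
\<close>

lemma power_mean_ge:
  fixes x :: "'a \<Rightarrow> real"
  assumes "finite A" "A \<noteq> {}" and x: "\<And>a. a \<in> A \<Longrightarrow> x a \<ge> 0" and w: "0 < w" "w \<le> (\<Sum>a\<in>A. x a)"
    and q: "real (card A) \<le> q" and l: "l \<ge> 1"
  shows "1 / q powr (l - 1) * w powr l \<le> (\<Sum>a\<in>A. x a powr l)"
proof -
  define c where "c = real (card A)"
  have c: "c > 0" using assms by (simp add: c_def card_gt_0_iff)
  define y where "y = w / c"
  have y: "y \<ge> 0" using w c by (simp add: y_def)
  have "1 / q powr (l - 1) * w powr l \<le> 1 / c powr (l - 1) * w powr l"
    using q c l by (intro mult_right_mono divide_left_mono powr_mono2) (auto simp: c_def)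
  also have "\<dots> = c * y powr l"
    using c w by (simp add: y_def powr_divide powr_diff)
  also have "\<dots> \<le> c * y powr l + l * y powr (l - 1) * ((\<Sum>a\<in>A. x a) - c * y)"
    using w c l by (simp add: y_def)
  also have "\<dots> = (\<Sum>a\<in>A. y powr l + l * y powr (l - 1) * (x a - y))"
    by (simp add: sum.distrib sum_subtractf c_def flip: sum_distrib_left)
  also have "\<dots> \<le> (\<Sum>a\<in>A. x a powr l)"
    using x y l by (intro sum_mono powr_above_tangent) auto
  finally show ?thesis .
qed

text \<open>
For \<open>0 \<le> t \<le> 1/(6n)\<close> all phases \<open>e(pt)\<close> lie within 60 degrees of 1, so the primes above \<open>z\<close> contribute
at least half of their number. The primes up to \<open>z\<close> may divide \<open>q\<close>; they change the sum over all
shifts by at most \<open>z\<^sup>2\<close>.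
\<close>

lemma sum_primitive_roots_exp_sum_ge:
  assumes z: "z \<ge> 1" and q: "q \<in> squarefrees z" and t: "0 \<le> t" "t \<le> 1 / (6 * real n)"
    and many: "4 * real z ^ 2 + 2 * real z \<le> real (card {p. prime p \<and> p \<le> n})"
  shows "real (card {p. prime p \<and> p \<le> n}) / 4
    \<le> (\<Sum>\<omega>\<in>primitive_roots q. norm (\<Sum>p | prime p \<and> p \<le> n. e (real p * t) * \<omega> ^ p))"
proof -
  define A where "A = {p. prime p \<and> p \<le> n}"
  define A1 where "A1 = {p\<in>A. p \<le> z}"
  define A2 where "A2 = {p\<in>A. z < p}"
  define E where "E = (\<lambda>p. e (real p * t))"
  have A12: "A = A1 \<union> A2" "A1 \<inter> A2 = {}" "finite A1" "finite A2"
    by (auto simp: A1_def A2_def A_def)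
  have q0: "q > 0" "q \<le> z" "squarefree q" using q squarefree_pos by (auto simp: squarefrees_def)
  have cq: "norm (primitive_root_sum q) = 1" using primitive_root_sum_squarefree[OF q0(3)] by auto
  have finq: "finite (primitive_roots q)" using q0 by auto
  have card_A: "real (card A) = real (card A1) + real (card A2)"
    using A12 by (simp add: card_Un_disjoint)
  have "A1 \<subseteq> {1..z}" using prime_gt_0_nat by (auto simp: A1_def A_def Suc_le_eq)
  then have "card A1 \<le> z" using card_mono[of "{1..z}" A1] by simp
  then have cA1: "real (card A1) \<le> real z" by simp
  have ReE: "1 / 2 \<le> Re (E p)" if "p \<in> A2" for p
  proof -
    have p: "real p \<le> real n" "p > 0" using that by (auto simp: A2_def A_def)
    then have n: "real n > 0" by linarith
    have "real p * t \<le> real n * (1 / (6 * real n))" using t p by (intro mult_mono) auto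
    then have "real p * t \<le> 1 / 6" using n by simp
    then have "pi * (2 * (real p * t)) \<le> pi * (1 / 3)" by (intro mult_left_mono) auto
    then have "cos (pi / 3) \<le> cos (2 * pi * (real p * t))"
      using t by (intro cos_monotone_0_pi_le) (auto simp: mult_ac)
    then show ?thesis by (simp add: E_def e_eq_cis cos_60)
  qed
  have "real (card A2) / 2 \<le> (\<Sum>p\<in>A2. Re (E p))"
    using sum_mono[of A2 "\<lambda>p. 1 / 2" "\<lambda>p. Re (E p)"] ReE by simp
  also have "\<dots> \<le> norm (\<Sum>p\<in>A2. E p)" by (simp flip: Re_sum) (rule complex_Re_le_cmod)
  finally have big: "real (card A2) / 2 \<le> norm (\<Sum>p\<in>A2. E p)" .
  have "(\<Sum>\<omega>\<in>primitive_roots q. \<Sum>p\<in>A2. E p * \<omega> ^ p) = (\<Sum>p\<in>A2. E p * primitive_root_sum q)"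
  proof -
    have "(\<Sum>\<omega>\<in>primitive_roots q. \<Sum>p\<in>A2. E p * \<omega> ^ p) = (\<Sum>p\<in>A2. \<Sum>\<omega>\<in>primitive_roots q. E p * \<omega> ^ p)"
      by (rule sum.swap)
    also have "\<dots> = (\<Sum>p\<in>A2. E p * primitive_root_sum q)"
    proof (intro sum.cong refl)
      fix p assume p: "p \<in> A2"
      have "coprime p q"
      proof (rule prime_imp_coprime)
        show "prime p" using p by (auto simp: A2_def A_def)
        show "\<not> p dvd q" using p q0 by (auto simp: A2_def dest!: dvd_imp_le)
      qed
      then show "(\<Sum>\<omega>\<in>primitive_roots q. E p * \<omega> ^ p) = E p * primitive_root_sum q"
        using sum_primitive_roots_power[of p q] q0 by (simp flip: sum_distrib_left)
    qed
    finally show ?thesis .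
  qed
  then have "norm (\<Sum>p\<in>A2. E p) = norm (\<Sum>\<omega>\<in>primitive_roots q. \<Sum>p\<in>A2. E p * \<omega> ^ p)"
    using cq by (simp add: norm_mult flip: sum_distrib_right)
  also have "\<dots> = norm ((\<Sum>\<omega>\<in>primitive_roots q. \<Sum>p\<in>A. E p * \<omega> ^ p) - (\<Sum>\<omega>\<in>primitive_roots q. \<Sum>p\<in>A1. E p * \<omega> ^ p))"
    unfolding A12(1) using A12 by (simp add: sum.union_disjoint sum.distrib)
  also have "\<dots> \<le> norm (\<Sum>\<omega>\<in>primitive_roots q. \<Sum>p\<in>A. E p * \<omega> ^ p) + norm (\<Sum>\<omega>\<in>primitive_roots q. \<Sum>p\<in>A1. E p * \<omega> ^ p)"
    by (rule norm_triangle_ineq4)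
  also have "norm (\<Sum>\<omega>\<in>primitive_roots q. \<Sum>p\<in>A. E p * \<omega> ^ p) \<le> (\<Sum>\<omega>\<in>primitive_roots q. norm (\<Sum>p\<in>A. E p * \<omega> ^ p))"
    by (rule norm_sum)
  also have "norm (\<Sum>\<omega>\<in>primitive_roots q. \<Sum>p\<in>A1. E p * \<omega> ^ p) \<le> (\<Sum>\<omega>\<in>primitive_roots q. real (card A1))"
  proof (intro sum_norm_le)
    fix \<omega> assume "\<omega> \<in> primitive_roots q"
    then have "norm \<omega> = 1" using norm_primitive_root q0 by blast
    then have "norm (\<Sum>p\<in>A1. E p * \<omega> ^ p) \<le> (\<Sum>p\<in>A1. 1)"
      by (intro sum_norm_le) (simp add: norm_mult norm_power E_def)
    then show "norm (\<Sum>p\<in>A1. E p * \<omega> ^ p) \<le> real (card A1)" by simp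
  qed
  also have "\<dots> \<le> real z * real z"
    using card_primitive_roots_le[OF q0(1)] q0(2) cA1 by (simp, intro mult_mono) auto
  finally have "real (card A2) / 2 \<le> (\<Sum>\<omega>\<in>primitive_roots q. norm (\<Sum>p\<in>A. E p * \<omega> ^ p)) + real z * real z"
    using big by simp
  then show ?thesis
    using card_A cA1 many unfolding A_def[symmetric] by (simp add: power2_eq_square E_def)
qed

lemma ex_angle:
  assumes "\<omega> ^ q = 1" "q > 0"
  obtains k where "k < q" "e (real k / real q) = \<omega>"
proof -
  have "\<omega> \<in> (\<lambda>k. cis (2 * pi * real k / real q)) ` {..<q}"
    using Complex.bij_betw_roots_unity[OF assms(2)] assms(1) by (auto simp: bij_betw_def)
  then show ?thesis using that by (auto simp: e_eq_cis)
qed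

text \<open>
Integrate the preceding bound, after the power mean inequality, over the one-sided arcs of length
\<open>1/(6n)\<close> that start at the fractions \<open>a/q\<close>. One-sided arcs stay inside the unit interval, because \<open>a/q \<le> 1 - 1/q\<close>,
and they are disjoint, because distinct fractions differ by at least \<open>1/z\<^sup>2\<close>.
\<close>

lemma integral_prime_exp_sum_ge:
  assumes z: "z \<ge> 1" "real z ^ 2 < 6 * real n" and l: "l \<ge> 2"
    and many: "4 * real z ^ 2 + 2 * real z \<le> real (card {p. prime p \<and> p \<le> n})"
  shows "1 / (6 * real n) * ((real (card {p. prime p \<and> p \<le> n}) / 4) powr l * (\<Sum>q\<in>squarefrees z. 1 / real q powr (l - 1)))
    \<le> integral {0..1} (\<lambda>\<alpha>. norm (\<Sum>p | prime p \<and> p \<le> n. e (real p * \<alpha>)) powr l)"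
proof -
  define A where "A = {p. prime p \<and> p \<le> n}"
  define f where "f = (\<lambda>\<alpha>. norm (\<Sum>p\<in>A. e (real p * \<alpha>)) powr l)"
  define h where "h = 1 / (6 * real n)"
  define w where "w = real (card A) / 4"
  define C where "C = w powr l * (\<Sum>q\<in>squarefrees z. 1 / real q powr (l - 1))"
  define I where "I = Sigma (squarefrees z) primitive_roots"
  have "4 * real 1 ^ 2 + 2 * real 1 \<le> 4 * real z ^ 2 + 2 * real z"
    using z by (intro add_mono mult_left_mono power_mono) auto
  then have w0: "w > 0" using many by (simp add: w_def A_def)
  have n0: "n > 0" using z by (auto intro!: Nat.gr0I)
  have h0: "h \<ge> 0" by (simp add: h_def)
  have finI: "finite I" unfolding I_def by (auto intro!: finite_SigmaI simp: squarefrees_def dest: squarefree_pos)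
  have memI: "fst i > 0" "fst i \<le> z" "snd i ^ fst i = 1" "fst i \<in> squarefrees z" if "i \<in> I" for i
    using that squarefree_pos[of "fst i"] primitive_rootsD[of "snd i" "fst i" "fst i"]
    by (auto simp: I_def squarefrees_def)
  have "\<forall>i. \<exists>k. i \<in> I \<longrightarrow> k < fst i \<and> e (real k / real (fst i)) = snd i"
    using ex_angle[OF memI(3,1)] by blast
  then obtain k where k: "\<And>i. i \<in> I \<Longrightarrow> k i < fst i \<and> e (real (k i) / real (fst i)) = snd i" by metis
  define \<theta> where "\<theta> = (\<lambda>i. real (k i) / real (fst i))"
  have e\<theta>: "e (\<theta> i) = snd i" if "i \<in> I" for i using k[OF that] by (simp add: \<theta>_def)
  have hz: "h * (real z)\<^sup>2 < 1" using z n0 by (simp add: h_def divide_less_eq mult.commute)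
  have sub: "0 \<le> \<theta> i \<and> \<theta> i + h \<le> 1" if i: "i \<in> I" for i
  proof -
    have "real (k i) + 1 \<le> real (fst i)" using k[OF i] by linarith
    then have "\<theta> i + 1 / real (fst i) \<le> 1"
      using memI(1)[OF i] unfolding \<theta>_def by (simp add: divide_le_eq flip: add_divide_distrib)
    moreover have "h \<le> 1 / real (fst i)"
    proof -
      have "real (fst i) \<le> (real z)\<^sup>2"
        using memI(2)[OF i] z(1) self_le_power[of "real z" 2] by linarith
      then have "h * real (fst i) \<le> h * (real z)\<^sup>2" using h0 by (intro mult_left_mono)
      then show ?thesis using hz memI(1)[OF i] by (simp add: le_divide_eq)
    qed
    ultimately show ?thesis by (simp add: \<theta>_def)
  qed
  have sep: "h < \<bar>\<theta> i - \<theta> j\<bar>" if ij: "i \<in> I" "j \<in> I" "i \<noteq> j" for i j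
  proof -
    have ne: "\<theta> i \<noteq> \<theta> j"
    proof
      assume "\<theta> i = \<theta> j"
      then have "snd i = snd j" using e\<theta> ij by metis
      then have "i = j" using ij primitive_roots_order_unique[of "snd i" "fst i" "fst j"]
        by (auto simp: I_def prod_eq_iff)
      then show False using ij by simp
    qed
    define a where "a = int (k i) * int (fst j) - int (k j) * int (fst i)"
    have q: "real (fst i) > 0" "real (fst j) > 0" using memI ij by auto
    have eq: "\<theta> i - \<theta> j = real_of_int a / (real (fst i) * real (fst j))"
      using q by (simp add: \<theta>_def a_def diff_frac_eq)
    then have "a \<noteq> 0" using ne by auto
    then have "1 \<le> \<bar>real_of_int a\<bar>" by linarith
    have "real (fst i) * real (fst j) \<le> real z * real z" using memI ij by (intro mult_mono) auto
    then have "h * (real (fst i) * real (fst j)) \<le> h * (real z)\<^sup>2"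
      using h0 by (intro mult_left_mono) (auto simp: power2_eq_square)
    then have "h * (real (fst i) * real (fst j)) < \<bar>real_of_int a\<bar>" using hz \<open>1 \<le> \<bar>real_of_int a\<bar>\<close> by linarith
    then show ?thesis unfolding eq using q by (simp add: abs_divide abs_mult less_divide_eq)
  qed
  have cont: "continuous_on UNIV f"
    using continuous_exp_sum_powr[of l "\<lambda>_. 1" A] l by (simp add: f_def)
  have pointwise: "C \<le> (\<Sum>i\<in>I. f (t + \<theta> i))" if t: "t \<in> {0..h}" for t
  proof -
    have "C = (\<Sum>q\<in>squarefrees z. 1 / real q powr (l - 1) * w powr l)"
      by (simp add: C_def sum_distrib_left mult.commute)
    also have "\<dots> \<le> (\<Sum>q\<in>squarefrees z. \<Sum>\<omega>\<in>primitive_roots q. norm (\<Sum>p\<in>A. e (real p * t) * \<omega> ^ p) powr l)"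
    proof (rule sum_mono)
      fix q assume q: "q \<in> squarefrees z"
      then have q0: "q > 0" using squarefree_pos by (auto simp: squarefrees_def)
      have ge: "w \<le> (\<Sum>\<omega>\<in>primitive_roots q. norm (\<Sum>p\<in>A. e (real p * t) * \<omega> ^ p))"
        unfolding w_def A_def using z q t many by (intro sum_primitive_roots_exp_sum_ge) (auto simp: h_def)
      then have "primitive_roots q \<noteq> {}" using w0 by auto
      then show "1 / real q powr (l - 1) * w powr l \<le> (\<Sum>\<omega>\<in>primitive_roots q. norm (\<Sum>p\<in>A. e (real p * t) * \<omega> ^ p) powr l)"
        using ge w0 q0 l card_primitive_roots_le[OF q0] by (intro power_mean_ge) auto
    qed
    also have "\<dots> = (\<Sum>i\<in>I. norm (\<Sum>p\<in>A. e (real p * t) * snd i ^ p) powr l)"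
      unfolding I_def by (subst sum.Sigma) (auto simp: case_prod_unfold squarefrees_def dest: squarefree_pos)
    also have "\<dots> = (\<Sum>i\<in>I. f (t + \<theta> i))"
      using exp_sum_shift[of "\<lambda>_. 1" t _ A] by (intro sum.cong refl) (simp add: f_def e\<theta>)
    finally show ?thesis .
  qed
  have "1 / (6 * real n) * C = integral {0..h} (\<lambda>t. C)" using h0 by (simp add: h_def)
  also have "\<dots> \<le> integral {0..h} (\<lambda>t. \<Sum>i\<in>I. f (t + \<theta> i))"
    by (intro integral_le pointwise)
       (auto intro!: integrable_continuous_real continuous_on_compose2[OF cont] continuous_intros)
  also have "\<dots> \<le> integral {0..1} f"
    using sum_integral_arcs_le[OF cont _ finI h0 sub sep] by (simp add: f_def)
  finally show ?thesis unfolding C_def f_def w_def A_def .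
qed

section \<open>Comparison of the two moments\<close>

lemma exp_minus_1_ge: "1 / 3 \<le> exp (-1::real)"
  using exp_le by (simp add: exp_minus field_simps)

text \<open>
Put \<open>\<delta> = l - 2\<close>. The left-hand side is at most \<open>1 + min(ln n, 2/\<delta>)\<close>. On the right, for every \<open>y \<le> z\<close> the
squarefree numbers up to \<open>y\<close> give at least half of \<open>y^(-\<delta>) ln (y + 1)\<close>. The choice of \<open>y\<close> as the smaller
one of \<open>z\<close> and \<open>exp (1/\<delta>)\<close> keeps \<open>y^(-\<delta>)\<close> at least \<open>1/e\<close> and makes the logarithm comparable with the
minimum on the left.
\<close>

lemma sum_powr_le_sum_squarefrees_powr:
  assumes z: "z \<ge> 10" "n \<le> z ^ 7" "n \<ge> 1" and l: "l \<ge> 2"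
  shows "(\<Sum>i=1..n. 1 / real i powr (l / 2)) \<le> 43 * (\<Sum>q\<in>squarefrees z. 1 / real q powr (l - 1))"
proof -
  define H where "H = (\<Sum>i=1..n. 1 / real i powr (l / 2))"
  define L where "L = (\<Sum>q\<in>squarefrees z. 1 / real q powr (l - 1))"
  define \<delta> where "\<delta> = l - 2"
  have \<delta>0: "\<delta> \<ge> 0" using l by (simp add: \<delta>_def)
  have L1: "L \<ge> 1"
  proof -
    have "(\<Sum>q\<in>{1::nat}. 1 / real q powr (l - 1)) \<le> L"
      unfolding L_def using z by (intro sum_mono2) (auto simp: squarefrees_def)
    then show ?thesis by simp
  qed
  have lower: "1 / real y powr \<delta> * ln (real y + 1) \<le> 2 * L" if y: "y \<ge> 1" "y \<le> z" for y :: nat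
  proof -
    have "1 / real y powr \<delta> * ln (real y + 1) \<le> 1 / real y powr \<delta> * (2 * (\<Sum>q\<in>squarefrees y. 1 / real q))"
      by (intro mult_left_mono ln_le_sum_squarefrees) auto
    also have "\<dots> = 2 * (\<Sum>q\<in>squarefrees y. 1 / real y powr \<delta> * (1 / real q))"
      by (simp add: sum_distrib_left mult_ac)
    also have "(\<Sum>q\<in>squarefrees y. 1 / real y powr \<delta> * (1 / real q)) \<le> (\<Sum>q\<in>squarefrees y. 1 / real q powr (l - 1))"
    proof (rule sum_mono)
      fix q assume "q \<in> squarefrees y"
      then have q: "q > 0" "q \<le> y" using squarefree_pos by (auto simp: squarefrees_def)
      have "1 / real y powr \<delta> * (1 / real q) \<le> 1 / real q powr \<delta> * (1 / real q)"
        using q \<delta>0 by (intro mult_right_mono divide_left_mono powr_mono2) auto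
      also have "\<dots> = 1 / real q powr (l - 1)"
      proof -
        have "real q powr (l - 1) = real q powr \<delta> * real q powr 1"
          by (simp only: powr_add[symmetric]) (simp add: \<delta>_def)
        then show ?thesis using q by simp
      qed
      finally show "1 / real y powr \<delta> * (1 / real q) \<le> 1 / real q powr (l - 1)" .
    qed
    also have "\<dots> \<le> L" unfolding L_def using y by (intro sum_mono2) (auto simp: squarefrees_def)
    finally show ?thesis by simp
  qed
  have powr_ge: "1 / 3 \<le> 1 / real y powr \<delta>" if "y \<ge> 1" "\<delta> * ln (real y) \<le> 1" for y :: nat
  proof -
    have "exp (-1) \<le> exp (- (\<delta> * ln (real y)))" using that by simp
    also have "\<dots> = 1 / real y powr \<delta>" using that by (simp add: powr_def exp_minus inverse_eq_divide)
    finally show ?thesis using exp_minus_1_ge by linarith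
  qed
  have "H \<le> 43 * L"
  proof (cases "\<delta> * ln (real z) \<le> 1")
    case True
    have "1 / 3 * ln (real z + 1) \<le> 1 / real z powr \<delta> * ln (real z + 1)"
      using powr_ge[of z] True z by (intro mult_right_mono) auto
    also have "\<dots> \<le> 2 * L" using lower[of z] z by simp
    finally have 1: "ln (real z + 1) \<le> 6 * L" by simp
    have "ln (real n) \<le> ln (real z ^ 7)"
    proof -
      have "real n \<le> real (z ^ 7)" using z(2) by (simp only: of_nat_le_iff)
      then show ?thesis using z by (subst ln_le_cancel_iff) auto
    qed
    also have "\<dots> = 7 * ln (real z)" using z by (simp add: ln_realpow)
    also have "\<dots> \<le> 7 * ln (real z + 1)" using z by simp
    finally have "ln (real n) \<le> 42 * L" using 1 by linarith
    moreover have "H \<le> 1 + ln (real n)" unfolding H_def using l z by (intro sum_powr_le_ln) auto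
    ultimately show ?thesis using L1 by linarith
  next
    case False
    then have \<delta>: "\<delta> > 0" using \<delta>0 by (cases "\<delta> = 0") auto
    define y where "y = nat \<lfloor>exp (1 / \<delta>)\<rfloor>"
    have ex1: "exp (1 / \<delta>) \<ge> 1" using \<delta> by simp
    have y1: "y \<ge> 1" using ex1 by (simp add: y_def le_nat_floor)
    have yle: "real y \<le> exp (1 / \<delta>)" using ex1 by (simp add: y_def)
    have ygt: "exp (1 / \<delta>) < real y + 1" using ex1 by (simp add: y_def)
    have lny: "ln (real y) \<le> 1 / \<delta>"
      using yle y1 by (metis ln_exp ln_le_cancel_iff exp_gt_zero of_nat_0_less_iff less_le_trans zero_less_one)
    have "exp (1 / \<delta>) \<le> real z"
    proof -
      have "1 / \<delta> \<le> ln (real z)" using False \<delta> by (simp add: divide_le_eq mult.commute)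
      then show ?thesis using z by (simp add: ln_ge_iff)
    qed
    then have yz: "y \<le> z" using yle by linarith
    have "1 / 3 * (1 / \<delta>) \<le> 1 / real y powr \<delta> * ln (real y + 1)"
    proof (rule mult_mono)
      show "1 / 3 \<le> 1 / real y powr \<delta>"
        using lny \<delta> y1 by (intro powr_ge) (auto simp: le_divide_eq mult.commute)
      show "1 / \<delta> \<le> ln (real y + 1)" using ygt by (simp add: ln_ge_iff)
    qed (use \<delta> in auto)
    also have "\<dots> \<le> 2 * L" by (rule lower[OF y1 yz])
    finally have "1 / \<delta> \<le> 6 * L" by simp
    moreover have "H \<le> 1 + 1 / (\<delta> / 2)"
      using sum_powr_tail_le[of "\<delta> / 2" n] \<delta> by (simp add: H_def \<delta>_def add_divide_distrib diff_divide_distrib)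
    ultimately show ?thesis using L1 by simp
  qed
  then show ?thesis unfolding H_def L_def .
qed

text \<open>
Both moments are compared with \<open>(\<pi>^l / n) \<Sum> q^(1-l)\<close>. The quotient of the two estimates is
at most \<open>258 * 819200^(l/2)\<close>, where 258 collects 43 from the comparison of the sums and 6 from the
length of the arcs. As \<open>l \<ge> 2\<close>, this is at most \<open>(10^10)^(l/2)\<close>, whose \<open>l\<close>-th root is \<open>10^5\<close>.
\<close>

theorem theorem1p4:
  fixes N l :: real and u :: "nat \<Rightarrow> complex"
  assumes "N \<ge> 10 ^ 6"
    and "l \<ge> 2"
    and "(\<Sum>p\<in>primes_upto N. (norm (u p))\<^sup>2) \<le> (\<Sum>p\<in>primes_upto N. 1)"
  shows "(integral {0..1} (\<lambda>\<alpha>::real.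
            norm (\<Sum>p\<in>primes_upto N. u p * e (real p * \<alpha>)) powr l)) powr (1 / l)
         \<le> 10 ^ 5 * (integral {0..1} (\<lambda>\<alpha>::real.
            norm (\<Sum>p\<in>primes_upto N. e (real p * \<alpha>)) powr l)) powr (1 / l)"
proof -
  define n where "n = nat \<lfloor>N\<rfloor>"
  have P: "primes_upto N = {p. prime p \<and> p \<le> n}"
  proof -
    have "real p \<le> N \<longleftrightarrow> p \<le> n" for p
      using assms(1) by (simp add: n_def le_nat_iff le_floor_iff)
    then show ?thesis by (simp add: primes_upto_def)
  qed
  define A where "A = {p. prime p \<and> p \<le> n}"
  define \<pi> where "\<pi> = real (card A)"
  define IU where "IU = integral {0..1} (\<lambda>\<alpha>. norm (\<Sum>p\<in>A. u p * e (real p * \<alpha>)) powr l)"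
  define IS where "IS = integral {0..1} (\<lambda>\<alpha>. norm (\<Sum>p\<in>A. e (real p * \<alpha>)) powr l)"
  define U where "U = (\<Sum>p\<in>A. (norm (u p))\<^sup>2)"
  define L where "L = ln (real n)"
  have "n \<ge> 10 ^ 6" using assms(1) by (simp add: n_def le_nat_floor)
  then obtain z where z: "z \<ge> 10" "z ^ 6 \<le> n" "n \<le> z ^ 7" using ex_sixth_root by blast
  have n6: "real n \<ge> 1000000" using \<open>n \<ge> 10 ^ 6\<close> by simp
  have L0: "L > 0" using n6 by (simp add: L_def)
  have U\<pi>: "0 \<le> U" "U \<le> \<pi>" using assms(3) by (simp_all add: P A_def U_def \<pi>_def sum_nonneg)
  have cheb: "real n \<le> 4 * \<pi> * L"
    unfolding \<pi>_def A_def L_def using n6 by (intro chebyshev_lower_bound) auto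
  have \<pi>0: "\<pi> > 0"
  proof (rule ccontr)
    assume "\<not> \<pi> > 0"
    then have "\<pi> = 0" by (simp add: \<pi>_def)
    then show False using cheb n6 by simp
  qed
  have many: "4 * real z ^ 2 + 2 * real z \<le> \<pi>"
  proof -
    have "L \<le> ln (real z ^ 7)"
    proof -
      have "real n \<le> real (z ^ 7)" using z(3) by (simp only: of_nat_le_iff)
      then show ?thesis unfolding L_def using z n6 by (subst ln_le_cancel_iff) auto
    qed
    also have "\<dots> \<le> 7 * real z" using z ln_bound[of "real z"] by (simp add: ln_realpow)
    finally have L7: "L \<le> 7 * real z" .
    have "real z ^ 6 \<le> real n" using z(2) by (metis of_nat_le_iff of_nat_power)
    also have "\<dots> \<le> 4 * \<pi> * (7 * real z)" using cheb L7 \<pi>0 by (meson mult_left_mono order_trans mult_nonneg_nonneg less_imp_le zero_le_numeral)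
    finally have "real z * real z ^ 5 \<le> real z * (28 * \<pi>)" by (simp add: eval_nat_numeral mult_ac)
    then have 5: "real z ^ 5 \<le> 28 * \<pi>" using z by simp
    have "10 * real z \<le> real z ^ 2" using z by (simp add: power2_eq_square)
    then have "28 * (4 * real z ^ 2 + 2 * real z) \<le> 1000 * real z ^ 2" using z by simp
    also have "\<dots> \<le> real z ^ 3 * real z ^ 2"
      using power_mono[of 10 "real z" 3] z by (intro mult_right_mono) auto
    also have "\<dots> = real z ^ 5" by (simp add: eval_nat_numeral)
    finally show ?thesis using 5 by simp
  qed
  define Q where "Q = (\<Sum>q\<in>squarefrees z. 1 / real q powr (l - 1))"
  have Q0: "Q \<ge> 0" by (simp add: Q_def sum_nonneg)
  have IU0: "IU \<ge> 0"
    unfolding IU_def using assms(2)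
    by (intro integral_nonneg integrable_continuous_real continuous_on_subset[OF continuous_exp_sum_powr]) auto
  have IS0: "IS \<ge> 0"
    unfolding IS_def using assms(2) continuous_exp_sum_powr[of l "\<lambda>_. 1" A]
    by (intro integral_nonneg integrable_continuous_real) (auto intro: continuous_on_subset)
  have lower: "1 / (6 * real n) * ((\<pi> / 4) powr l * Q) \<le> IS"
    unfolding IS_def A_def Q_def \<pi>_def
  proof (rule integral_prime_exp_sum_ge)
    have "real z ^ 2 \<le> real z ^ 6" using z by (intro power_increasing) auto
    also have "\<dots> \<le> real n" using z(2) by (metis of_nat_le_iff of_nat_power)
    finally show "real z ^ 2 < 6 * real n" using n6 by linarith
  qed (use z assms(2) many in \<open>auto simp: \<pi>_def A_def\<close>)
  \<comment> \<open>Chebyshev's bound turns \<open>n / ln n\<close> into \<open>4 \<pi>\<close>; the constant is \<open>2 * 6400 * 4 * 16\<close>.\<close>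
  have base_le: "(2 * (6400 * real n / L * U)) powr (l / 2) \<le> (819200 * (\<pi> / 4)\<^sup>2) powr (l / 2)"
  proof (rule powr_mono2)
    have "real n / L \<le> 4 * \<pi>" using cheb L0 by (simp add: divide_le_eq)
    then have "real n / L * U \<le> 4 * \<pi> * \<pi>" using U\<pi> L0 \<pi>0 by (intro mult_mono) auto
    then show "2 * (6400 * real n / L * U) \<le> 819200 * (\<pi> / 4)\<^sup>2" by (simp add: power2_eq_square)
    show "0 \<le> 2 * (6400 * real n / L * U)" using U\<pi> L0 by simp
  qed (use assms(2) in simp)
  have sum_le: "(\<Sum>i=1..n. 1 / real i powr (l / 2)) \<le> 43 * Q"
    unfolding Q_def using z assms(2) n6 by (intro sum_powr_le_sum_squarefrees_powr) auto
  have "IU \<le> 1 / real n * ((2 * (6400 * real n / L * U)) powr (l / 2) * (\<Sum>i=1..n. 1 / real i powr (l / 2)))"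
    unfolding IU_def A_def U_def L_def by (rule integral_exp_sum_le[OF z assms(2)])
  also have "\<dots> \<le> 1 / real n * ((819200 * (\<pi> / 4)\<^sup>2) powr (l / 2) * (43 * Q))"
    using base_le sum_le by (intro mult_left_mono mult_mono) (auto intro: sum_nonneg)
  also have "(819200 * (\<pi> / 4)\<^sup>2) powr (l / 2) = 819200 powr (l / 2) * (\<pi> / 4) powr l"
    using \<pi>0 by (simp add: powr_mult powr_powr flip: powr_numeral)
  also have "1 / real n * (819200 powr (l / 2) * (\<pi> / 4) powr l * (43 * Q)) = 258 * 819200 powr (l / 2) * (1 / (6 * real n) * ((\<pi> / 4) powr l * Q))"
    by simp
  also have "\<dots> \<le> 258 * 819200 powr (l / 2) * IS" using lower by (intro mult_left_mono) auto
  also have "\<dots> \<le> 10000000000 powr (l / 2) * IS"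
  proof (intro mult_right_mono IS0)
    have "(258::real) = 258 powr 1" by simp
    also have "\<dots> \<le> 258 powr (l / 2)" using assms(2) by (intro powr_mono) auto
    finally have "258 * 819200 powr (l / 2) \<le> 258 powr (l / 2) * 819200 powr (l / 2)" by (intro mult_right_mono) auto
    also have "\<dots> = (258 * 819200) powr (l / 2)" by (rule powr_mult[symmetric])
    also have "\<dots> \<le> 10000000000 powr (l / 2)" using assms(2) by (intro powr_mono2) auto
    finally show "258 * 819200 powr (l / 2) \<le> (10000000000::real) powr (l / 2)" .
  qed
  finally have main: "IU \<le> 10000000000 powr (l / 2) * IS" .
  have "IU powr (1 / l) \<le> (10000000000 powr (l / 2) * IS) powr (1 / l)"
    using main IU0 assms(2) by (intro powr_mono2) auto
  also have "\<dots> = (10000000000 powr (l / 2)) powr (1 / l) * IS powr (1 / l)"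
    by (rule powr_mult)
  also have "(10000000000 powr (l / 2)) powr (1 / l) = (10000000000::real) powr (1 / 2)"
    using assms(2) by (simp add: powr_powr)
  also have "\<dots> = 10 ^ 5"
    using real_sqrt_unique[of "10 ^ 5" "10000000000"] by (simp add: powr_half_sqrt)
  finally show ?thesis unfolding IU_def IS_def P A_def .
qed

end
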